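(* Let $p<q<r$ be primes and $w$ a positive integer such that $r\equiv w\pmod{pq}$, $p\equiv 1\pmod w$, and $q\equiv 1\pmod{pw}$. Then $A(pqr)=1$.
   Context: $\Phi_n(x)$ denotes the $n$th cyclotomic polynomial. The height $A(n)$ is the maximum absolute value of the coefficients of $\Phi_n(x)$. *)

theory Defs
  imports
    Complex_Main
    "HOL-Computational_Algebra.Polynomial"
    "HOL-Computational_Algebra.Primes"
    "HOL-Number_Theory.Cong"
begin

definition primitive_unity_roots :: "nat \<Rightarrow> complex set" where
  "primitive_unity_roots n = {z. z ^ n = 1 \<and> (\<forall>m. 0 < m \<and> m < n \<longrightarrow> z ^ m \<noteq> 1)}"

text \<open>
  The product is meant for \<open>n > 0\<close>, where the index set is finite.
  The coefficients are integers, but they are kept here as complex numbers.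
\<close>

definition cyclotomic_poly :: "nat \<Rightarrow> complex poly" where
  "cyclotomic_poly n = (\<Prod>z\<in>primitive_unity_roots n. [:- z, 1:])"

definition cyclotomic_height :: "nat \<Rightarrow> real" where
  "cyclotomic_height n =
     Max ((\<lambda>i. cmod (coeff (cyclotomic_poly n) i)) ` {..degree (cyclotomic_poly n)})"

end

theory Submission
  imports
    Defs
    "HOL-Computational_Algebra.Fundamental_Theorem_Algebra"
    "HOL-Computational_Algebra.Polynomial_FPS"
begin

text \<open>
  Write \<open>\<Phi>\<close> for the \<open>pq\<close>-th cyclotomic polynomial. The \<open>pqr\<close>-th one is \<open>\<Phi>(x^r) / \<Phi>(x)\<close>, and the
  coefficients \<open>chi\<close> of the power series \<open>1 / \<Phi>(x)\<close> are periodic modulo \<open>pq\<close>. Since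
  \<open>r \<equiv> w (mod pq)\<close>, each coefficient is a prefix of the sum \<open>\<Sum>j. a j * chi (t - w * j)\<close>, where
  \<open>a j\<close> are the coefficients of \<open>\<Phi>\<close>. As \<open>q \<equiv> 1 (mod p)\<close>, \<open>\<Phi>\<close> is explicitly a sum of pairs
  \<open>x^(ip) - x^(ip + 1 + i div l)\<close> plus a last power. The full sum vanishes and \<open>\<Phi>\<close> is
  palindromic, so it suffices to treat prefixes consisting of complete pairs.

  Differences of \<open>chi\<close> split, by the Chinese remainder theorem, into a factor modulo \<open>p\<close> and a
  factor modulo \<open>q\<close>. The congruence \<open>q \<equiv> 1 (mod pw)\<close> makes the factor modulo \<open>q\<close> single out one
  arithmetic progression (a row) of pairs. The prefix becomes the difference of two row sums, each of
  them telescopes to a value in \<open>{-1, 0, 1}\<close>, and the two values never have opposite signs.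
\<close>

section \<open>Cyclotomic polynomials of products of two and three primes\<close>

lemma unity_roots_partition:
  assumes "0 < n"
  shows "{z::complex. z ^ n = 1} = (\<Union>d\<in>{d. d dvd n}. primitive_unity_roots d)"
proof (intro equalityI subsetI)
  fix z :: complex assume "z \<in> {z. z ^ n = 1}"
  hence z: "z ^ n = 1" by simp
  define d where "d = (LEAST d. 0 < d \<and> z ^ d = 1)"
  have d: "0 < d \<and> z ^ d = 1" unfolding d_def by (rule LeastI[of _ n]) (use assms z in simp)
  have least: "\<not> (0 < m \<and> z ^ m = 1)" if "m < d" for m
    using not_less_Least that unfolding d_def by blast
  have "z ^ (n mod d) = 1"
  proof -
    have "z ^ n = z ^ (d * (n div d) + n mod d)" by simp
    also have "\<dots> = z ^ (n mod d)" unfolding power_add power_mult using d by simp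
    finally show ?thesis using z by simp
  qed
  hence "n mod d = 0" using least[of "n mod d"] d by auto
  hence "d dvd n" by auto
  moreover have "z \<in> primitive_unity_roots d" using d least by (auto simp: primitive_unity_roots_def)
  ultimately show "z \<in> (\<Union>d\<in>{d. d dvd n}. primitive_unity_roots d)" by blast
next
  fix z :: complex assume "z \<in> (\<Union>d\<in>{d. d dvd n}. primitive_unity_roots d)"
  then obtain d where "d dvd n" "z ^ d = 1" by (auto simp: primitive_unity_roots_def)
  thus "z \<in> {z. z ^ n = 1}" by (auto simp: power_mult elim!: dvdE)
qed

lemma primitive_unity_roots_disjoint:
  assumes "0 < d" "0 < e" "d \<noteq> e"
  shows "primitive_unity_roots d \<inter> primitive_unity_roots e = {}"
  using assms unfolding primitive_unity_roots_def by (auto simp: neq_iff)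

lemma finite_primitive_unity_roots: "0 < n \<Longrightarrow> finite (primitive_unity_roots n)"
  by (rule finite_subset[OF _ finite_roots_unity[of n]]) (auto simp: primitive_unity_roots_def)

text \<open>The polynomial shares no zero with its derivative, so its roots are simple; being monic,
  it is the product of its linear factors.\<close>

lemma prod_unity_roots:
  assumes "0 < n"
  shows "(\<Prod>z\<in>{z::complex. z ^ n = 1}. [:- z, 1:]) = monom 1 n - 1"
proof -
  let ?p = "monom 1 n - 1 :: complex poly"
  have deg: "degree ?p = n"
    using assms by (subst diff_conv_add_uminus, subst degree_add_eq_left) (auto simp: degree_monom_eq)
  have roots: "poly ?p z = 0 \<longleftrightarrow> z ^ n = 1" for z by (simp add: poly_monom)
  have "rsquarefree ?p"
    unfolding rsquarefree_roots
  proof (intro allI notI)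
    fix a assume "poly ?p a = 0 \<and> poly (pderiv ?p) a = 0"
    hence "a ^ n = 1" "of_nat n * a ^ (n - 1) = 0" by (auto simp: pderiv_diff pderiv_monom poly_monom)
    thus False using assms by (auto simp: power_0_left)
  qed
  hence "smult (lead_coeff ?p) (\<Prod>z | poly ?p z = 0. [:- z, 1:]) = ?p"
    by (rule complex_poly_decompose_rsquarefree)
  moreover have "lead_coeff ?p = 1" unfolding deg using assms by simp
  ultimately show ?thesis unfolding roots by simp
qed

lemma prod_cyclotomic_poly:
  assumes "0 < n"
  shows "(\<Prod>d\<in>{d. d dvd n}. cyclotomic_poly d) = monom 1 n - 1"
proof -
  have "(\<Prod>z\<in>(\<Union>d\<in>{d. d dvd n}. primitive_unity_roots d). [:- z, 1:]) =
      (\<Prod>d\<in>{d. d dvd n}. cyclotomic_poly d)"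
    unfolding cyclotomic_poly_def
  proof (rule prod.UNION_disjoint)
    show "finite {d. d dvd n}" using assms by simp
    show "\<forall>d\<in>{d. d dvd n}. finite (primitive_unity_roots d)"
      using assms finite_primitive_unity_roots by (auto intro: dvd_pos_nat)
    show "\<forall>d\<in>{d. d dvd n}. \<forall>e\<in>{d. d dvd n}. d \<noteq> e \<longrightarrow>
        primitive_unity_roots d \<inter> primitive_unity_roots e = {}"
      using assms primitive_unity_roots_disjoint dvd_pos_nat by (metis mem_Collect_eq)
  qed
  thus ?thesis using prod_unity_roots[OF assms] unity_roots_partition[OF assms] by simp
qed

lemma prod_divisors_prime_mult:
  fixes F :: "nat \<Rightarrow> 'a::comm_monoid_mult"
  assumes "prime p" "\<not> p dvd n" "0 < n"
  shows "(\<Prod>d\<in>{d. d dvd p * n}. F d) = (\<Prod>d\<in>{d. d dvd n}. F d) * (\<Prod>d\<in>{d. d dvd n}. F (p * d))"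
proof -
  have "{d. d dvd p * n} = {d. d dvd n} \<union> (*) p ` {d. d dvd n}"
  proof (intro equalityI subsetI)
    fix d assume "d \<in> {d. d dvd p * n}"
    hence d: "d dvd p * n" by simp
    show "d \<in> {d. d dvd n} \<union> (*) p ` {d. d dvd n}"
    proof (cases "p dvd d")
      case True
      then obtain e where e: "d = p * e" by blast
      thus ?thesis using d prime_gt_0_nat[OF assms(1)] by auto
    next
      case False
      hence "coprime d p" using assms(1) by (metis prime_imp_coprime coprime_commute)
      thus ?thesis using d by (simp add: coprime_dvd_mult_right_iff)
    qed
  qed auto
  moreover have "{d. d dvd n} \<inter> (*) p ` {d. d dvd n} = {}"
    using assms(2) by (auto dest: dvd_mult_left)
  moreover have "inj_on ((*) p) {d. d dvd n}"
    using prime_gt_0_nat[OF assms(1)] by (auto simp: inj_on_def)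
  ultimately show ?thesis using assms(3)
    by (simp add: prod.union_disjoint prod.reindex)
qed

text \<open>Moebius inversion with the denominators cleared, which avoids division of polynomials.
  Once every \<open>U\<close> is expanded over divisors, both sides are the same product of
  cyclotomic factors.\<close>

lemma cyclotomic_poly_three_primes:
  fixes p q r :: nat
  assumes pr: "prime p" "prime q" "prime r" and less: "p < q" "q < r"
  defines "U \<equiv> \<lambda>n. monom 1 n - 1 :: complex poly"
  shows "cyclotomic_poly (p * q * r) * (U (p * q) * U (p * r) * U (q * r) * U 1) =
    U (p * q * r) * U p * U q * U r"
proof -
  have U: "U n = (\<Prod>d\<in>{d. d dvd n}. cyclotomic_poly d)" if "0 < n" for n
    using prod_cyclotomic_poly[OF that] by (simp add: U_def)
  have pos: "0 < p" "0 < q" "0 < r" using pr prime_gt_0_nat by auto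
  have nd: "\<not> p dvd q" "\<not> p dvd r" "\<not> q dvd r"
    using pr less by (metis less_irrefl primes_dvd_imp_eq order.strict_trans)+
  have ndm: "\<not> p dvd q * r" using nd pr by (simp add: prime_dvd_mult_iff)
  let ?F = cyclotomic_poly
  have p1: "(\<Prod>d\<in>{d. d dvd s}. G d) = G 1 * G s" if "prime s" for s and G :: "nat \<Rightarrow> complex poly"
  proof -
    have "{d. d dvd s} = {1, s}" using that by (auto simp: prime_nat_iff)
    thus ?thesis using that by (auto simp: prime_nat_iff)
  qed
  have p2: "(\<Prod>d\<in>{d. d dvd s * t}. G d) = G 1 * G t * (G s * G (s * t))"
    if "prime s" "prime t" "\<not> s dvd t" for s t and G :: "nat \<Rightarrow> complex poly"
    using prod_divisors_prime_mult[OF that(1,3), of G] p1[OF that(2), of G] p1[OF that(2), of "\<lambda>d. G (s * d)"]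
      prime_gt_0_nat[OF that(2)] by simp
  have "(\<Prod>d\<in>{d. d dvd p * (q * r)}. ?F d) =
     ?F 1 * ?F r * (?F q * ?F (q * r)) * (?F p * ?F (p * r) * (?F (p * q) * ?F (p * (q * r))))"
    using prod_divisors_prime_mult[OF pr(1) ndm, of ?F] p2[OF pr(2,3) nd(3), of ?F]
      p2[OF pr(2,3) nd(3), of "\<lambda>d. ?F (p * d)"] pos by simp
  hence U3: "U (p * q * r) = ?F 1 * ?F r * (?F q * ?F (q * r)) * (?F p * ?F (p * r) * (?F (p * q) * ?F (p * q * r)))"
    using pos by (simp add: U mult.assoc)
  have U1: "U 1 = ?F 1" using U[of 1] by simp
  have Us: "U s = ?F 1 * ?F s" if "prime s" for s
    using U p1[OF that] prime_gt_0_nat[OF that] by simp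
  have Ust: "U (s * t) = ?F 1 * ?F t * (?F s * ?F (s * t))" if "prime s" "prime t" "\<not> s dvd t" for s t
    using U p2[OF that] prime_gt_0_nat that by simp
  show ?thesis
    unfolding U3 U1 Us[OF pr(1)] Us[OF pr(2)] Us[OF pr(3)] Ust[OF pr(1,2) nd(1)] Ust[OF pr(1,3) nd(2)]
      Ust[OF pr(2,3) nd(3)]
    by (simp only: mult_ac)
qed

text \<open>The first factor is the explicit form of the \<open>pq\<close>-th cyclotomic polynomial.
  With \<open>i = m * l + b\<close> the negative exponent is \<open>1 + m * q + b * p\<close>, so
  the negative part is \<open>y\<close> times two geometric sums, of steps \<open>q\<close> and
  \<open>p\<close>. The positive part is geometric as well, and
  \<open>L * p = (p - 1) * (q - 1)\<close>. A general \<open>y\<close> allows the later substitution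
  of a power of the series variable.\<close>

lemma semigroup_poly_identity:
  fixes y :: "'a::comm_ring_1" and p l :: nat
  assumes "0 < p"
  defines "L \<equiv> (p - 1) * l" and "q \<equiv> 1 + l * p"
  shows "((\<Sum>i<L + 1. y ^ (i * p)) - (\<Sum>i<L. y ^ (i * p + 1 + i div l))) * ((1 - y ^ p) * (1 - y ^ q)) =
    (1 - y ^ (p * q)) * (1 - y)"
proof -
  have A: "(1 - y ^ p) * (\<Sum>i<n. y ^ (i * p)) = 1 - y ^ (n * p)" for n
    using one_diff_power_eq[of "y ^ p" n] by (simp add: power_mult[symmetric] mult.commute)
  have B: "(1 - y ^ q) * (\<Sum>m<n. y ^ (m * q)) = 1 - y ^ (n * q)" for n
    using one_diff_power_eq[of "y ^ q" n] by (simp add: power_mult[symmetric] mult.commute)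
  have "(\<Sum>i<L. y ^ (i * p + 1 + i div l)) = (\<Sum>m<p - 1. \<Sum>i\<in>{m * l..<m * l + l}. y ^ (i * p + 1 + i div l))"
    unfolding L_def by (rule sum.nat_group[symmetric])
  also have "\<dots> = (\<Sum>m<p - 1. \<Sum>b<l. y * y ^ (m * q) * y ^ (b * p))"
  proof (rule sum.cong[OF refl])
    fix m
    have "(\<Sum>i\<in>{m * l..<m * l + l}. y ^ (i * p + 1 + i div l)) =
        (\<Sum>b<l. y ^ ((b + m * l) * p + 1 + (b + m * l) div l))"
      using sum.shift_bounds_nat_ivl[of "\<lambda>i. y ^ (i * p + 1 + i div l)" 0 "m * l" l]
      by (simp add: atLeast0LessThan add.commute)
    also have "\<dots> = (\<Sum>b<l. y * y ^ (m * q) * y ^ (b * p))"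
    proof (rule sum.cong[OF refl])
      fix b assume "b \<in> {..<l}"
      hence "(b + m * l) div l = m" by simp
      thus "y ^ ((b + m * l) * p + 1 + (b + m * l) div l) = y * y ^ (m * q) * y ^ (b * p)"
        by (simp add: q_def power_add algebra_simps)
    qed
    finally show "(\<Sum>i\<in>{m * l..<m * l + l}. y ^ (i * p + 1 + i div l)) =
        (\<Sum>b<l. y * y ^ (m * q) * y ^ (b * p))" .
  qed
  also have "\<dots> = y * (\<Sum>m<p - 1. y ^ (m * q)) * (\<Sum>b<l. y ^ (b * p))"
    unfolding mult.assoc sum_product by (simp only: sum_distrib_left)
  finally have neg: "(\<Sum>i<L. y ^ (i * p + 1 + i div l)) = y * (\<Sum>m<p - 1. y ^ (m * q)) * (\<Sum>b<l. y ^ (b * p))" .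
  have regroup: "(s1 - y * s2 * s3) * (a * b) = a * s1 * b - y * (b * s2) * (a * s3)" for a b s1 s2 s3 :: 'a
    by (simp add: algebra_simps)
  have "((\<Sum>i<L + 1. y ^ (i * p)) - (\<Sum>i<L. y ^ (i * p + 1 + i div l))) * ((1 - y ^ p) * (1 - y ^ q)) =
     ((1 - y ^ p) * (\<Sum>i<L + 1. y ^ (i * p))) * (1 - y ^ q) -
      y * ((1 - y ^ q) * (\<Sum>m<p - 1. y ^ (m * q))) * ((1 - y ^ p) * (\<Sum>b<l. y ^ (b * p)))"
    unfolding neg by (rule regroup)
  also have "\<dots> = (1 - y ^ ((L + 1) * p)) * (1 - y ^ q) - y * (1 - y ^ ((p - 1) * q)) * (1 - y ^ (l * p))"
    unfolding A B ..
  also have "\<dots> = (1 - y ^ (p * q)) * (1 - y)"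
  proof -
    obtain c where c: "p = Suc c" using assms(1) by (cases p) auto
    show ?thesis unfolding L_def q_def c by (simp add: algebra_simps power_add power_mult)
  qed
  finally show ?thesis .
qed

section \<open>Tools for power series, integer sums and division with remainder\<close>

unbundle fps_syntax

lemma fps_indicator_inverse:
  assumes "0 < N"
  shows "Abs_fps (\<lambda>n. of_bool (N dvd n)) * (1 - fps_X ^ N) = (1 :: 'a::comm_ring_1 fps)"
proof (rule fps_ext)
  fix n
  have "N dvd n \<longleftrightarrow> N dvd n - N" if "N \<le> n"
    using that dvd_minus_self[of N n] by auto
  moreover have "N dvd n \<longleftrightarrow> n = 0" if "n < N"
    using that dvd_imp_le[of N n] by auto
  ultimately show "(Abs_fps (\<lambda>n. of_bool (N dvd n)) * (1 - fps_X ^ N)) $ n = (1 :: 'a fps) $ n"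
    using assms by (auto simp: right_diff_distrib fps_X_power_mult_right_nth)
qed

lemma sum_int_step:
  fixes g :: "int \<Rightarrow> 'a::ab_group_add"
  assumes "0 \<le> n"
  shows "sum g {0..<n+1} = sum g {0..<n} + g n"
proof -
  have "{0..<n+1} = insert n {0..<n}" using assms by auto
  thus ?thesis by (simp add: add.commute)
qed

lemma sum_int_telescope:
  fixes g :: "int \<Rightarrow> 'a::ab_group_add"
  assumes "0 \<le> n"
  shows "(\<Sum>s\<in>{0..<n}. g s - g (s + 1)) = g 0 - g n"
  using assms by (induction n rule: int_ge_induct) (simp_all add: sum_int_step)

lemma block_div_mod:
  fixes a b n :: int
  assumes "0 \<le> b" "b < n"
  shows "(n * a + b) div n = a" "(n * a + b) mod n = b"
  using assms by (auto intro: int_div_pos_eq int_mod_pos_eq)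

lemma sum_int_nat: "(\<Sum>i\<in>{0..<int m}. g i) = (\<Sum>i<m. g (int i))"
  by (rule sum.reindex_bij_witness[of _ int nat]) auto

section \<open>Integer setting, the periodic coefficients \<open>chi\<close> and their
  differences\<close>

locale flat_triple =
  fixes p q w f k :: int
  assumes p_eq: "p = 1 + w * f" and q_eq: "q = 1 + p * w * k"
    and f_pos: "0 < f" and w_pos: "0 < w" and k_pos: "0 < k"
begin

lemma p_gt_1: "1 < p"
  using p_eq f_pos w_pos by (simp add: mult_pos_pos)

lemma w_less_p: "w < p"
  using p_eq mult_left_mono[of 1 f w] f_pos w_pos by linarith

lemma p_less_q: "p < q"
proof -
  have "1 * 1 \<le> w * k" using w_pos k_pos by (intro mult_mono) auto
  hence "p * 1 \<le> p * (w * k)" using p_gt_1 by (intro mult_left_mono) auto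
  thus ?thesis using q_eq by (simp add: mult.assoc)
qed

lemma coprime_w_p: "coprime w p"
proof (rule coprimeI)
  fix c assume "c dvd w" "c dvd p"
  hence "c dvd p - w * f" by (metis dvd_diff dvd_mult2)
  thus "is_unit c" by (simp add: p_eq)
qed

lemma coprime_p_q: "coprime p q"
proof (rule coprimeI)
  fix c assume "c dvd p" "c dvd q"
  hence "c dvd q - p * (w * k)" by (metis dvd_diff dvd_mult2)
  thus "is_unit c" by (simp add: q_eq mult.assoc)
qed

lemma pq_dvd_iff: "p * q dvd z \<longleftrightarrow> p dvd z \<and> q dvd z"
  using coprime_p_q by (meson divides_mult dvd_mult_left dvd_mult_right)

definition dv :: "int \<Rightarrow> int" where
  "dv x = of_bool (p dvd x)"

text \<open>The factor modulo \<open>p\<close> in \<open>chi_diff_1\<close>. Its second term stems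
  from a shift by \<open>q\<close>, which is a shift by 1 modulo \<open>p\<close>.\<close>

definition kap :: "int \<Rightarrow> int" where
  "kap x = dv x - dv (x - 1)"

text \<open>The coefficient of \<open>x^t\<close> in \<open>(1 + x + \<dots> + x^(p-1)) (1 - x^q) / (1 - x^(pq))\<close>, extended
  periodically to negative \<open>t\<close>.\<close>
definition chi :: "int \<Rightarrow> int" where
  "chi t = (\<Sum>i\<in>{0..<p}. of_bool (p * q dvd t - i) - of_bool (p * q dvd t - q - i))"

text \<open>The contribution of the first \<open>I\<close> complete pairs; \<open>w * k\<close> is
  the block length \<open>l\<close> of \<open>semigroup_poly_identity\<close>.\<close>

definition S :: "int \<Rightarrow> int \<Rightarrow> int" where
  "S I t = (\<Sum>i\<in>{0..<I}. chi (t - w * i * p) - chi (t - w * (i * p + 1 + i div (w * k))))"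

text \<open>Only the residues of \<open>u\<close> modulo \<open>p\<close> and of \<open>v\<close> modulo \<open>q\<close> matter, so these can be chosen
  independently; \<open>S_eq_H\<close> uses \<open>u = t\<close> with \<open>v = t\<close> and \<open>v = t - p\<close>.\<close>
definition H :: "int \<Rightarrow> int \<Rightarrow> int \<Rightarrow> int" where
  "H I u v = (\<Sum>i\<in>{0..<I}. \<Sum>s\<in>{0..<w * (1 + i div (w * k))}.
      kap (u - s) * of_bool (q dvd v - w * i * p - s))"

text \<open>The terms of \<open>H\<close> with \<open>i = k * e + a\<close> and \<open>s = \<tau> + e\<close>, for fixed \<open>a\<close> and \<open>\<tau>\<close>. Since
  \<open>w * p * k \<equiv> -1 (mod q)\<close>, they are exactly those with \<open>v \<equiv> \<tau> + w * p * a (mod q)\<close>.\<close>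
definition row :: "int \<Rightarrow> int \<Rightarrow> int \<Rightarrow> int" where
  "row E \<tau> u = (\<Sum>e\<in>{0..<E}. if 0 \<le> \<tau> + e \<and> \<tau> + e < w * (1 + e div w) then kap (u - \<tau> - e) else 0)"

lemma dv_add_mult: "dv (x - p * y) = dv x" "dv (x - y * p) = dv x"
   apply (simp_all add: dv_def)
   apply (metis dvd_diff_left_iff dvd_triv_left)
   apply (metis dvd_diff_left_iff dvd_triv_right)
  done

lemma kap_add_mult: "kap (x - y * p) = kap x"
  using dv_add_mult(2)[of x y] dv_add_mult(2)[of "x - 1" y]
  by (simp add: kap_def algebra_simps)

text \<open>The sum defining \<open>chi\<close> telescopes, leaving four indicators of divisibility
  by \<open>p * q\<close>, for \<open>t\<close> shifted by 0, \<open>q\<close>, \<open>p\<close> and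
  \<open>p + q\<close>. Coprimality splits each into one modulo \<open>p\<close> and one modulo
  \<open>q\<close>; as \<open>q\<close> is 1 modulo \<open>p\<close> and 0 modulo \<open>q\<close>,
  the four terms form a product.\<close>

lemma chi_diff_1:
  "chi t - chi (t - 1) = kap t * (of_bool (q dvd t) - of_bool (q dvd t - p))"
proof -
  let ?b = "\<lambda>z. of_bool (p * q dvd z) :: int"
  define g where "g = (\<lambda>s. ?b (t - s) - ?b (t - q - s))"
  have "chi t - chi (t - 1) = (\<Sum>s\<in>{0..<p}. g s - g (s + 1))"
    unfolding chi_def g_def sum_subtractf[symmetric]
    by (intro sum.cong refl) (simp add: algebra_simps)
  also have "\<dots> = g 0 - g p"
    using sum_int_telescope[of p g] p_gt_1 by simp
  finally have 1: "chi t - chi (t - 1) = g 0 - g p" .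
  have a: "p dvd t - q \<longleftrightarrow> p dvd t - 1"
  proof -
    have "t - q = t - 1 - p * (w * k)" by (simp add: q_eq algebra_simps)
    thus ?thesis by (metis dvd_diff_left_iff dvd_triv_left)
  qed
  have b: "p dvd t - p \<longleftrightarrow> p dvd t" "p dvd t - q - p \<longleftrightarrow> p dvd t - 1"
    using a dvd_diff_left_iff[of p p "t - q"] dvd_diff_left_iff[of p p t] by auto
  have c: "q dvd t - q \<longleftrightarrow> q dvd t" "q dvd t - q - p \<longleftrightarrow> q dvd t - p"
    using dvd_diff_left_iff[of q q "t - p"] dvd_diff_left_iff[of q q t]
    by (auto simp: algebra_simps)
  show ?thesis
    unfolding 1 g_def kap_def dv_def pq_dvd_iff
    using a b c by auto
qed

lemma chi_diff:
  assumes "0 \<le> m"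
  shows "chi t - chi (t - m) =
    (\<Sum>s\<in>{0..<m}. kap (t - s) * (of_bool (q dvd t - s) - of_bool (q dvd t - p - s)))"
proof -
  have "(\<Sum>s\<in>{0..<m}. chi (t - s) - chi (t - (s + 1))) = chi (t - 0) - chi (t - m)"
    using sum_int_telescope[of m "\<lambda>s. chi (t - s)"] assms by simp
  moreover have "chi (t - s) - chi (t - (s + 1)) =
      kap (t - s) * (of_bool (q dvd t - s) - of_bool (q dvd t - p - s))" for s
    using chi_diff_1[of "t - s"] by (simp add: algebra_simps)
  ultimately show ?thesis by simp
qed

text \<open>Each pair is a difference covered by \<open>chi_diff\<close>. Its starting shift
  \<open>w * i * p\<close> is a multiple of \<open>p\<close>, so it disappears from
  \<open>kap\<close> and survives only modulo \<open>q\<close>.\<close>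

lemma S_eq_H: "S I t = H I t t - H I t (t - p)"
proof -
  have "chi (t - w * i * p) - chi (t - w * (i * p + 1 + i div (w * k))) =
     (\<Sum>s\<in>{0..<w * (1 + i div (w * k))}. kap (t - s) * of_bool (q dvd t - w * i * p - s)) -
     (\<Sum>s\<in>{0..<w * (1 + i div (w * k))}. kap (t - s) * of_bool (q dvd t - p - w * i * p - s))"
    if "i \<in> {0..<I}" for i
  proof -
    have nn: "0 \<le> w * (1 + i div (w * k))"
      using that w_pos k_pos by (simp add: pos_imp_zdiv_nonneg_iff)
    have e: "t - w * i * p - w * (1 + i div (w * k)) = t - w * (i * p + 1 + i div (w * k))"
      by (simp add: algebra_simps)
    have kk: "kap (t - w * i * p - s) = kap (t - s)" for s
      using kap_add_mult[of "t - s" "w * i"] by (simp add: algebra_simps)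
    have pp: "t - w * i * p - p - s = t - p - w * i * p - s" for s by simp
    show ?thesis
      using chi_diff[OF nn, of "t - w * i * p"] unfolding e kk pp
      by (simp add: sum_subtractf right_diff_distrib)
  qed
  thus ?thesis unfolding S_def H_def
    by (simp add: sum_subtractf)
qed

section \<open>The nonzero terms of \<open>H\<close> form a single row\<close>

definition xpos :: "int \<Rightarrow> int" where
  "xpos v = (v + (p - 1) * w) mod q"

lemma wp_pos: "0 < w * p"
  using w_pos p_gt_1 by simp

lemma xpos_bounds: "0 \<le> xpos v" "xpos v \<le> w * p * k"
proof -
  have q0: "0 < q" using p_less_q p_gt_1 by simp
  show "0 \<le> xpos v" using q0 by (simp add: xpos_def)
  have "xpos v < q" using q0 by (simp add: xpos_def)
  also have "q = w * p * k + 1" by (simp add: q_eq)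
  finally show "xpos v \<le> w * p * k" by simp
qed

lemma xpos_div_bounds:
  assumes "xpos v < w * p * k"
  shows "0 \<le> xpos v div (w * p)" "xpos v div (w * p) < k"
proof -
  show "0 \<le> xpos v div (w * p)" using xpos_bounds wp_pos by (simp add: pos_imp_zdiv_nonneg_iff)
  have "w * p * (xpos v div (w * p)) \<le> xpos v"
    using wp_pos pos_mod_sign[of "w * p" "xpos v"] mult_div_mod_eq[of "w * p" "xpos v"] by linarith
  hence "w * p * (xpos v div (w * p)) < w * p * k" using assms by linarith
  thus "xpos v div (w * p) < k" using wp_pos mult_less_cancel_left_pos by blast
qed

text \<open>The number of \<open>e \<ge> 0\<close> with \<open>k * e + a < I\<close>.\<close>
definition rows :: "int \<Rightarrow> int \<Rightarrow> int" where
  "rows I a = (I - a + k - 1) div k"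

lemma less_rows_iff: "e < rows I a \<longleftrightarrow> k * e + a < I"
proof -
  have "e < rows I a \<longleftrightarrow> e + 1 \<le> (I - a + k - 1) div k" by (auto simp: rows_def)
  also have "\<dots> \<longleftrightarrow> (e + 1) * k \<le> I - a + k - 1"
  proof -
    have "(I - a + k - 1 + (- (e + 1)) * k) div k = - (e + 1) + (I - a + k - 1) div k"
      using k_pos by (intro div_mult_self1) simp
    thus ?thesis
      using pos_imp_zdiv_nonneg_iff[OF k_pos, of "I - a + k - 1 + (- (e + 1)) * k"] by linarith
  qed
  also have "\<dots> \<longleftrightarrow> k * e + a < I" by (auto simp: algebra_simps)
  finally show ?thesis .
qed

lemma div_block:
  assumes "0 \<le> e" "0 \<le> a" "a < k"
  shows "(k * e + a) div (w * k) = e div w"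
proof -
  have "(k * e + a) div (w * k) = (k * e + a) div k div w"
    using k_pos w_pos by (simp add: zdiv_zmult2_eq mult.commute)
  also have "(k * e + a) div k = e" using assms by (simp add: block_div_mod)
  finally show ?thesis .
qed

lemma w_div_bounds: "w * (e div w) \<le> e" "e < w * (e div w) + w"
  using w_pos pos_mod_bound[of w e] pos_mod_sign[of w e] mult_div_mod_eq[of w e] by linarith+

text \<open>Put \<open>i = k * e + a\<close>. Because \<open>w * p * k = q - 1\<close>, the
  condition modulo \<open>q\<close> says that \<open>xpos v\<close> equals
  \<open>z = w * p * a + y\<close> with \<open>y = s - e + (p - 1) * w\<close>. The shift by
  \<open>(p - 1) * w\<close>, also built into \<open>xpos\<close>, brings \<open>y\<close> strictly
  between 0 and \<open>w * p\<close>: \<open>e < (p - 1) * w\<close> gives the lower bound and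
  \<open>s - e < w\<close> the upper one. Hence \<open>a\<close> and \<open>y\<close> are the
  quotient and the remainder of \<open>xpos v\<close> by \<open>w * p\<close>.\<close>

lemma dvd_window:
  assumes i: "0 \<le> i" "i < (p - 1) * (w * k)"
    and s: "0 \<le> s" "s < w * (1 + i div (w * k))"
  shows "q dvd v - w * i * p - s \<longleftrightarrow>
    (xpos v < w * p * k \<and> i mod k = xpos v div (w * p) \<and>
     s = xpos v mod (w * p) - (p - 1) * w + i div k)"
proof -
  define e a where "e = i div k" and "a = i mod k"
  have ie: "i = k * e + a" by (simp add: e_def a_def)
  have a: "0 \<le> a" "a < k" using k_pos by (simp_all add: a_def)
  have e0: "0 \<le> e" using i k_pos by (simp add: e_def pos_imp_zdiv_nonneg_iff)
  have e1: "e < (p - 1) * w"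
  proof -
    have "k * e < k * ((p - 1) * w)" using i a
      unfolding ie by (simp only: mult_ac)
    thus ?thesis using k_pos mult_less_cancel_left_pos by blast
  qed
  have s1: "s < w * (1 + e div w)" using s div_block[OF e0 a] ie by simp
  define y where "y = s - e + (p - 1) * w"
  have y: "0 < y" "y < w * p"
  proof -
    show "0 < y" using e1 s by (simp add: y_def)
    have "s - e < w" using s1 w_div_bounds[of e] by (simp add: algebra_simps)
    thus "y < w * p" by (simp add: y_def algebra_simps)
  qed
  define z where "z = w * p * a + y"
  note wp = wp_pos
  have z: "0 \<le> z" "z < w * p * k"
  proof -
    show "0 \<le> z" using wp a y by (simp add: z_def)
    have "w * p * (a + 1) \<le> w * p * k" using a wp by (intro mult_left_mono) auto
    thus "z < w * p * k" using y by (simp add: z_def algebra_simps)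
  qed
  have zq: "z < q" using z q_eq by (simp add: mult_ac)
  have "v - w * i * p - s = v + (p - 1) * w - z - q * e"
    by (simp add: ie z_def y_def q_eq algebra_simps)
  hence "q dvd v - w * i * p - s \<longleftrightarrow> q dvd v + (p - 1) * w - z"
    by (metis dvd_diff_left_iff dvd_triv_left)
  also have "\<dots> \<longleftrightarrow> (v + (p - 1) * w) mod q = z mod q"
    by (simp add: mod_eq_dvd_iff)
  also have "\<dots> \<longleftrightarrow> xpos v = z" using z zq by (simp add: xpos_def)
  also have "\<dots> \<longleftrightarrow> xpos v < w * p * k \<and> a = xpos v div (w * p) \<and> y = xpos v mod (w * p)"
  proof
    assume "xpos v = z"
    thus "xpos v < w * p * k \<and> a = xpos v div (w * p) \<and> y = xpos v mod (w * p)"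
      using z y block_div_mod[of y "w * p" a] by (simp add: z_def)
  next
    assume "xpos v < w * p * k \<and> a = xpos v div (w * p) \<and> y = xpos v mod (w * p)"
    thus "xpos v = z" by (simp add: z_def)
  qed
  also have "\<dots> \<longleftrightarrow> (xpos v < w * p * k \<and> i mod k = xpos v div (w * p) \<and>
     s = xpos v mod (w * p) - (p - 1) * w + i div k)"
    by (auto simp: y_def a_def e_def)
  finally show ?thesis .
qed

text \<open>The remaining value of \<open>xpos v\<close> is \<open>w * p * k = q - 1\<close>, which
  no pair of \<open>i\<close> and \<open>s\<close> in the window reaches.\<close>

lemma H_hole:
  assumes "I \<le> (p - 1) * (w * k)" "\<not> xpos v < w * p * k"
  shows "H I u v = 0"
  unfolding H_def using assms by (auto intro!: sum.neutral simp: dvd_window)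

text \<open>By \<open>dvd_window\<close>, \<open>v\<close> fixes \<open>i mod k\<close> and
  \<open>s - i div k\<close>. So each admissible \<open>i\<close> carries at most one
  \<open>s\<close>, and \<open>e = i div k\<close> parametrises the terms.\<close>

lemma H_eq_row:
  assumes I: "I \<le> (p - 1) * (w * k)" and x: "xpos v < w * p * k"
  shows "H I u v = row (rows I (xpos v div (w * p))) (xpos v mod (w * p) - (p - 1) * w) u"
proof -
  define a \<tau> where "a = xpos v div (w * p)" and "\<tau> = xpos v mod (w * p) - (p - 1) * w"
  have a: "0 \<le> a" "a < k" using xpos_div_bounds[OF x] by (simp_all add: a_def)
  define G where "G = (\<lambda>e. if 0 \<le> \<tau> + e \<and> \<tau> + e < w * (1 + e div w) then kap (u - \<tau> - e) else 0)"
  have inner: "(\<Sum>s\<in>{0..<w * (1 + i div (w * k))}. kap (u - s) * of_bool (q dvd v - w * i * p - s))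
      = (if i mod k = a then G (i div k) else 0)" if i: "i \<in> {0..<I}" for i
  proof -
    have db: "i div (w * k) = i div k div w"
      using k_pos w_pos by (simp add: zdiv_zmult2_eq mult.commute)
    have "(\<Sum>s\<in>{0..<w * (1 + i div (w * k))}. kap (u - s) * of_bool (q dvd v - w * i * p - s))
      = (\<Sum>s\<in>{0..<w * (1 + i div (w * k))}. if s = \<tau> + i div k then (if i mod k = a then kap (u - s) else 0) else 0)"
      using i I x by (intro sum.cong refl) (auto simp: dvd_window a_def \<tau>_def)
    also have "\<dots> = (if i mod k = a then G (i div k) else 0)"
        unfolding G_def db by (subst sum.delta) (auto simp: diff_diff_eq)
    finally show ?thesis .
  qed
  have "H I u v = (\<Sum>i\<in>{0..<I}. if i mod k = a then G (i div k) else 0)"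
    unfolding H_def by (intro sum.cong refl inner)
  also have "\<dots> = (\<Sum>i\<in>{i\<in>{0..<I}. i mod k = a}. G (i div k))"
    by (intro sum.inter_filter[symmetric]) simp
  also have "\<dots> = (\<Sum>e\<in>{0..<rows I a}. G e)"
  proof (rule sum.reindex_bij_witness[of _ "\<lambda>e. k * e + a" "\<lambda>i. i div k"])
    fix i assume "i \<in> {i\<in>{0..<I}. i mod k = a}"
    hence i: "0 \<le> i" "i < I" "a = i mod k" by auto
    show e: "k * (i div k) + a = i" using i by simp
    show "i div k \<in> {0..<rows I a}" using i e k_pos
      by (simp add: less_rows_iff pos_imp_zdiv_nonneg_iff)
  next
    fix e assume e: "e \<in> {0..<rows I a}"
    show "(k * e + a) div k = e" using a by (simp add: block_div_mod)
    show "k * e + a \<in> {i\<in>{0..<I}. i mod k = a}"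
      using e a k_pos by (simp add: less_rows_iff)
  qed auto
  also have "\<dots> = row (rows I a) \<tau> u" by (simp add: row_def G_def)
  finally show ?thesis by (simp add: a_def \<tau>_def)
qed

section \<open>Values and signs of a single row\<close>

lemma row_nonpos:
  assumes "\<tau> \<le> 0" "0 \<le> E"
  shows "row E \<tau> u = dv u - dv (u - max 0 (E + \<tau>))"
  using assms(2)
proof (induction E rule: int_ge_induct)
  case base
  show ?case using assms(1) by (simp add: row_def)
next
  case (step E)
  \<comment> \<open>For \<open>\<tau> \<le> 0\<close> the upper end of the window never cuts
    anything off. Only the terms with \<open>\<tau> + e < 0\<close> are missing, so the sum
    telescopes from \<open>u\<close> itself; this is the source of the \<open>max\<close>.\<close>
  have "\<tau> + E < w * (1 + E div w)" using assms(1) w_div_bounds(2)[of E] by (simp add: algebra_simps)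
  hence "row (E + 1) \<tau> u = row E \<tau> u + (if 0 \<le> \<tau> + E then kap (u - \<tau> - E) else 0)"
    unfolding row_def using step by (subst sum_int_step) auto
  moreover have "kap (u - \<tau> - E) = dv (u - (E + \<tau>)) - dv (u - (E + 1 + \<tau>))"
    by (simp add: kap_def algebra_simps)
  ultimately have *: "row (E + 1) \<tau> u = dv u - dv (u - max 0 (E + \<tau>)) +
      (if 0 \<le> E + \<tau> then dv (u - (E + \<tau>)) - dv (u - (E + 1 + \<tau>)) else 0)"
    using step.IH by (simp add: add.commute)
  consider "0 \<le> E + \<tau>" | "\<tau> = - 1 - E" | "E + 1 + \<tau> < 0" by linarith
  thus ?case using * by cases (simp_all add: max_def)
qed

text \<open>For \<open>\<tau> > 0\<close> the window keeps only the first \<open>w - \<tau>\<close>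
  terms of each block of \<open>w\<close> consecutive \<open>e\<close>, and these telescope. The sum
  collects the complete blocks; the last two terms come from the incomplete one, whose length is
  capped at \<open>w - \<tau>\<close>.\<close>

lemma row_pos_closed:
  assumes t: "0 < \<tau>" "\<tau> < w" "0 \<le> E"
  shows "row E \<tau> u = (\<Sum>m\<in>{0..<E div w}. dv (u - \<tau> - w * m) - dv (u - w - w * m))
    + dv (u - \<tau> - w * (E div w)) - dv (u - (\<tau> + min (w - \<tau>) (E mod w)) - w * (E div w))"
  using t(3)
proof (induction E rule: int_ge_induct)
  case base
  show ?case using t by (simp add: row_def)
next
  case (step E)
  define M \<epsilon> where "M = E div w" and "\<epsilon> = E mod w"
  have E: "E = w * M + \<epsilon>" by (simp add: M_def \<epsilon>_def)
  have \<epsilon>: "0 \<le> \<epsilon>" "\<epsilon> < w" using w_pos by (simp_all add: \<epsilon>_def)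
  have M: "0 \<le> M" using step w_pos by (simp add: M_def pos_imp_zdiv_nonneg_iff)
  have cond: "\<tau> + E < w * (1 + E div w) \<longleftrightarrow> \<epsilon> < w - \<tau>"
    unfolding M_def[symmetric] by (simp add: E algebra_simps)
  have "row (E + 1) \<tau> u = row E \<tau> u + (if \<epsilon> < w - \<tau> then kap (u - \<tau> - E) else 0)"
    unfolding row_def using step t by (subst sum_int_step) (auto simp: cond)
  also have "row E \<tau> u = (\<Sum>m\<in>{0..<M}. dv (u - \<tau> - w * m) - dv (u - w - w * m))
    + dv (u - \<tau> - w * M) - dv (u - (\<tau> + min (w - \<tau>) \<epsilon>) - w * M)"
    using step.IH unfolding M_def \<epsilon>_def .
  finally have *: "row (E + 1) \<tau> u = (\<Sum>m\<in>{0..<M}. dv (u - \<tau> - w * m) - dv (u - w - w * m))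
    + dv (u - \<tau> - w * M) - dv (u - (\<tau> + min (w - \<tau>) \<epsilon>) - w * M)
    + (if \<epsilon> < w - \<tau> then kap (u - \<tau> - E) else 0)" .
  show ?case
  proof (cases "\<epsilon> = w - 1")
    case True
    have E1: "E + 1 = w * (M + 1)" by (simp add: E True algebra_simps)
    have d: "(E + 1) div w = M + 1" "(E + 1) mod w = 0" using w_pos by (simp_all add: E1)
    show ?thesis using * t unfolding d sum_int_step[OF M]
      by (simp add: True min_def algebra_simps)
  next
    case False
    have E1: "E + 1 = w * M + (\<epsilon> + 1)" by (simp add: E)
    have d: "(E + 1) div w = M" "(E + 1) mod w = \<epsilon> + 1"
      using \<epsilon> False by (simp_all add: E1 block_div_mod)
    have "kap (u - \<tau> - E) = dv (u - (\<tau> + \<epsilon>) - w * M) - dv (u - (\<tau> + (\<epsilon> + 1)) - w * M)"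
      by (simp add: kap_def E algebra_simps)
    moreover have "min (w - \<tau>) \<epsilon> = \<epsilon>" "min (w - \<tau>) (\<epsilon> + 1) = \<epsilon> + 1" if "\<epsilon> < w - \<tau>"
      using that by auto
    moreover have "min (w - \<tau>) \<epsilon> = w - \<tau>" "min (w - \<tau>) (\<epsilon> + 1) = w - \<tau>" if "\<not> \<epsilon> < w - \<tau>"
      using that by auto
    ultimately show ?thesis using * unfolding d by (cases "\<epsilon> < w - \<tau>") simp_all
  qed
qed

lemma dvd_w_cancel: "p dvd w * z \<longleftrightarrow> p dvd z"
  using coprime_w_p by (metis coprime_commute coprime_dvd_mult_right_iff)

text \<open>Multiples of \<open>w\<close> become consecutive modulo \<open>p\<close> after dividing by \<open>w\<close>, whose inverse is \<open>- f\<close>.\<close>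
lemma dv_conv:
  assumes "p dvd u - w * g"
  shows "dv (u - x - w * m) = of_bool (p dvd g + f * x - m)"
proof -
  have "u - x - w * m = w * (g + f * x - m) + (u - w * g - p * x)"
    by (simp add: p_eq algebra_simps)
  moreover have "p dvd u - w * g - p * x" using assms by simp
  ultimately have "p dvd u - x - w * m \<longleftrightarrow> p dvd w * (g + f * x - m)"
    by (metis dvd_add_left_iff)
  thus ?thesis by (simp add: dv_def dvd_w_cancel)
qed

lemma dvd_small:
  assumes z: "- p < z" "z < 2 * p"
  shows "p dvd z \<longleftrightarrow> z = 0 \<or> z = p"
proof
  assume "p dvd z"
  then obtain c where c: "z = p * c" by blast
  have p0: "0 < p" using p_gt_1 by simp
  have "p * - 1 < p * c" "p * c < p * 2" using z c by linarith+
  hence "- 1 < c" "c < 2" unfolding mult_less_cancel_left_pos[OF p0] .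
  hence "c = 0 \<or> c = 1" by linarith
  thus "z = 0 \<or> z = p" using c by auto
qed auto

lemma count_dvd:
  assumes z: "0 \<le> z" "z < 2 * p" and M: "0 \<le> M" "M \<le> p"
  shows "(\<Sum>m\<in>{0..<M}. of_bool (p dvd z - m)) = (of_bool (z < M \<or> p \<le> z \<and> z < p + M) :: int)"
  using M
proof (induction M rule: int_ge_induct)
  case (step M)
  have "p dvd z - M \<longleftrightarrow> z = M \<or> z = p + M" using dvd_small[of "z - M"] z step by auto
  thus ?case using step by (subst sum_int_step) (auto simp: of_bool_def)
qed (use z in auto)

text \<open>Writing \<open>u\<close> as \<open>w * g\<close> modulo \<open>p\<close> turns the
  closed form, through \<open>dv_conv\<close>, into counts of consecutive residues. The products
  \<open>f * \<tau>\<close>, \<open>f * w\<close> and \<open>f * (\<tau> + c)\<close> lie between 1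
  and \<open>p - 1\<close>, so all numbers stay in the range of \<open>count_dvd\<close> and
  \<open>dvd_small\<close>, and only comparisons of integers remain.\<close>

lemma row_pos:
  assumes t: "0 < \<tau>" "\<tau> < w" and E: "0 \<le> E" "E \<le> (p - 1) * w"
    and g: "p dvd u - w * g" "0 \<le> g" "g < p"
    and M: "M = E div w" and c: "c = min (w - \<tau>) (E mod w)"
  shows "row E \<tau> u = of_bool (g + f * \<tau> < M \<or> p \<le> g + f * \<tau> \<and> g + f * \<tau> < p + M)
     - of_bool (1 \<le> g \<and> g \<le> M)
     + of_bool (g + f * \<tau> = M \<or> g + f * \<tau> = p + M)
     - of_bool (g + f * (\<tau> + c) = M \<or> g + f * (\<tau> + c) = p + M)" "0 \<le> M" "M \<le> p - 1"
proof -
  have w0: "0 \<le> E mod w" using w_pos by simp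
  have fw: "f * w = p - 1" by (simp add: p_eq mult.commute)
  show M0: "0 \<le> M" using E w_pos by (simp add: M pos_imp_zdiv_nonneg_iff)
  show M1: "M \<le> p - 1" using zdiv_mono1[OF E(2) w_pos] w_pos by (simp add: M)
  have ft: "0 < f * \<tau>" "f * \<tau> \<le> f * w" using t f_pos by (simp_all add: mult_pos_pos mult_left_mono)
  have fc: "0 < f * (\<tau> + c)" "f * (\<tau> + c) \<le> f * w"
  proof -
    have "0 < \<tau> + c" "\<tau> + c \<le> w" unfolding c using t w0 by linarith+
    thus "0 < f * (\<tau> + c)" "f * (\<tau> + c) \<le> f * w"
      using f_pos by (simp_all add: mult_pos_pos mult_left_mono)
  qed
  have "row E \<tau> u = (\<Sum>m\<in>{0..<M}. of_bool (p dvd (g + f * \<tau>) - m) - of_bool (p dvd (g + f * w) - m))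
      + of_bool (p dvd (g + f * \<tau>) - M) - of_bool (p dvd (g + f * (\<tau> + c)) - M)"
    unfolding row_pos_closed[OF t E(1)] dv_conv[OF g(1)] M c ..
  also have "\<dots> = of_bool (g + f * \<tau> < M \<or> p \<le> g + f * \<tau> \<and> g + f * \<tau> < p + M)
     - of_bool (g + f * w < M \<or> p \<le> g + f * w \<and> g + f * w < p + M)
     + of_bool (g + f * \<tau> = M \<or> g + f * \<tau> = p + M)
     - of_bool (g + f * (\<tau> + c) = M \<or> g + f * (\<tau> + c) = p + M)"
  proof -
    have c: "(\<Sum>m\<in>{0..<M}. of_bool (p dvd (g + f * y) - m)) =
        (of_bool (g + f * y < M \<or> p \<le> g + f * y \<and> g + f * y < p + M) :: int)"
      and d: "p dvd (g + f * y) - M \<longleftrightarrow> g + f * y = M \<or> g + f * y = p + M"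
      if "0 < f * y" "f * y \<le> f * w" for y
      using that g M0 M1 fw count_dvd[of "g + f * y" M] dvd_small[of "g + f * y - M"] by auto
    have "f * w \<le> f * w" "0 < f * w" using p_gt_1 fw by auto
    thus ?thesis unfolding sum_subtractf using c[of w] c[OF ft] d[OF ft] d[OF fc] by presburger
  qed
  also have "g + f * w < M \<or> p \<le> g + f * w \<and> g + f * w < p + M \<longleftrightarrow> 1 \<le> g \<and> g \<le> M"
    using g M1 unfolding fw by auto
  finally show "row E \<tau> u = of_bool (g + f * \<tau> < M \<or> p \<le> g + f * \<tau> \<and> g + f * \<tau> < p + M)
     - of_bool (1 \<le> g \<and> g \<le> M)
     + of_bool (g + f * \<tau> = M \<or> g + f * \<tau> = p + M)
     - of_bool (g + f * (\<tau> + c) = M \<or> g + f * (\<tau> + c) = p + M)" .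
qed

lemma ex_residue: "\<exists>g. p dvd u - w * g \<and> 0 \<le> g \<and> g < p"
proof (intro exI conjI)
  let ?g = "(- f * u) mod p"
  have "p dvd - f * u - ?g" by (simp add: mod_eq_dvd_iff[symmetric])
  hence "p dvd p * u + w * (- f * u - ?g)" by simp
  also have "p * u + w * (- f * u - ?g) = u - w * ?g" by (simp add: p_eq algebra_simps)
  finally show "p dvd u - w * ?g" .
  show "0 \<le> ?g" "?g < p" using p_gt_1 by simp_all
qed

text \<open>The sign statements concern those \<open>u\<close> at which a row with nonpositive
  offset can be 1 or -1; they are what \<open>mixed_rows\<close> needs. After \<open>row_pos\<close>
  everything is arithmetic, split by whether the incomplete block is cut off, that is, by comparing
  \<open>\<tau> + \<epsilon>\<close> with \<open>w\<close>.\<close>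

lemma row_pos_bounds:
  assumes t: "0 < \<tau>" "\<tau> < w" and E: "0 \<le> E" "E \<le> (p - 1) * w"
  shows "\<bar>row E \<tau> u\<bar> \<le> 1"
    and "p dvd u \<Longrightarrow> 0 \<le> row E \<tau> u"
    and "\<not> p dvd u \<Longrightarrow> p dvd u - (E + \<tau>) \<Longrightarrow> row E \<tau> u \<le> 0"
    and "\<not> p dvd u \<Longrightarrow> p dvd u - (E + \<tau> - 1) \<Longrightarrow> p * w - p \<le> E + \<tau> - 1 \<Longrightarrow> row E \<tau> u \<le> 0"
proof -
  obtain g where g: "p dvd u - w * g" "0 \<le> g" "g < p" using ex_residue by blast
  define M \<epsilon> where "M = E div w" and "\<epsilon> = E mod w"
  have E_eq: "E = w * M + \<epsilon>" by (simp add: M_def \<epsilon>_def)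
  have \<epsilon>: "0 \<le> \<epsilon>" "\<epsilon> < w" using w_pos by (simp_all add: \<epsilon>_def)
  have fw: "f * w = p - 1" by (simp add: p_eq mult.commute)
  \<comment> \<open>Multiplication by \<open>f\<close> carries \<open>w\<close> to
    \<open>p - 1\<close>. So \<open>C\<close> is \<open>A + B\<close> capped at
    \<open>p - 1\<close>.\<close>
  define A B C where "A = f * \<tau>" and "B = f * \<epsilon>" and "C = f * (\<tau> + min (w - \<tau>) \<epsilon>)"
  define R where "R = row E \<tau> u"
  note R = row_pos[OF t E g M_def refl, folded \<epsilon>_def, folded A_def C_def R_def]
  have M: "0 \<le> M" "M \<le> p - 1" using R(2,3) .
  \<comment> \<open>A started incomplete block leaves room for at most \<open>p - 2\<close> complete
    ones.\<close>
  have M2: "M \<le> p - 2" if "0 < \<epsilon>"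
  proof -
    have "w * M < w * (p - 1)" using E E_eq that by (simp add: mult.commute)
    thus ?thesis using w_pos by simp
  qed
  have A: "f \<le> A" "A \<le> p - 1 - f"
  proof -
    show "f \<le> A" using t f_pos mult_left_mono[of 1 \<tau> f] by (simp add: A_def)
    have "f * \<tau> \<le> f * (w - 1)" using t f_pos by (intro mult_left_mono) auto
    thus "A \<le> p - 1 - f" using fw by (simp add: A_def right_diff_distrib)
  qed
  have B: "0 \<le> B" "B \<le> p - 1 - f" "0 < \<epsilon> \<Longrightarrow> f \<le> B" "\<epsilon> = 0 \<Longrightarrow> B = 0"
  proof -
    show "0 \<le> B" using \<epsilon> f_pos by (simp add: B_def)
    show "f \<le> B" if "0 < \<epsilon>" using that f_pos mult_left_mono[of 1 \<epsilon> f] by (simp add: B_def)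
    have "f * \<epsilon> \<le> f * (w - 1)" using \<epsilon> f_pos by (intro mult_left_mono) auto
    thus "B \<le> p - 1 - f" using fw by (simp add: B_def right_diff_distrib)
  qed (simp add: B_def)
  have AB: "A + B = f * (\<tau> + \<epsilon>)" by (simp add: A_def B_def algebra_simps)
  have C1: "C = A + B" "C \<le> p - 1" if "\<tau> + \<epsilon> \<le> w"
  proof -
    show "C = A + B" using that by (simp add: C_def AB min_def)
    thus "C \<le> p - 1" using that f_pos mult_left_mono[of "\<tau> + \<epsilon>" w f] fw by (simp add: AB)
  qed
  have C2: "C = p - 1" if "w \<le> \<tau> + \<epsilon>"
    using that fw by (simp add: C_def min_def)
  have AB2: "p - 1 \<le> A + B" if "w \<le> \<tau> + \<epsilon>"
    using that f_pos mult_left_mono[of w "\<tau> + \<epsilon>" f] fw by (simp add: AB)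
  have AB3: "p - 1 + f \<le> A + B" if "w + 1 \<le> \<tau> + \<epsilon>"
    using that f_pos mult_left_mono[of "w + 1" "\<tau> + \<epsilon>" f] fw by (simp add: AB distrib_left)
  have p0: "p dvd u \<longleftrightarrow> g = 0"
  proof -
    have "dv (u - 0 - w * 0) = of_bool (p dvd g)" unfolding dv_conv[OF g(1)] by simp
    thus ?thesis using g dvd_small[of g] by (auto simp: dv_def)
  qed
  have R1: "\<bar>R\<bar> \<le> 1 \<and> (g = 0 \<longrightarrow> 0 \<le> R)"
  proof (cases "\<tau> + \<epsilon> \<le> w")
    case True
    show ?thesis using R(1) M A B(1) C1[OF True] g by (smt (verit) of_bool_def)
  next
    case False
    hence "C = p - 1" "M \<le> p - 2" using C2 M2 t by auto
    thus ?thesis using R(1) M A g by (smt (verit) of_bool_def)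
  qed
  show "\<bar>row E \<tau> u\<bar> \<le> 1" using R1 by (simp add: R_def)
  show "0 \<le> row E \<tau> u" if "p dvd u" using R1 p0 that by (simp add: R_def)
  show "row E \<tau> u \<le> 0" if u: "\<not> p dvd u" "p dvd u - (E + \<tau>)"
  proof -
    have g1: "1 \<le> g" using u(1) p0 g by simp
    have "dv (u - (\<epsilon> + \<tau>) - w * M) = 1" using u(2) by (simp add: dv_def E_eq algebra_simps)
    hence "p dvd g + f * (\<epsilon> + \<tau>) - M" unfolding dv_conv[OF g(1)] by simp
    also have "g + f * (\<epsilon> + \<tau>) - M = g + A + B - M" by (simp add: A_def B_def algebra_simps)
    finally have d: "p dvd g + A + B - M" .
    show ?thesis
    proof (cases "\<tau> + \<epsilon> \<le> w")
      case True
      hence "g + C = M \<or> g + C = p + M" using d C1[OF True] dvd_small[of "g + A + B - M"] M A B(1) g f_pos by (smt (verit))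
      thus ?thesis using R(1) M p_gt_1 unfolding R_def[symmetric] by (smt (verit) of_bool_def)
    next
      case False
      hence c: "C = p - 1" "M \<le> p - 2" "p - 1 \<le> A + B" using C2 M2 t AB2 by auto
      \<comment> \<open>As \<open>C = p - 1\<close>, the row is the indicator of
        \<open>g + A \<le> M\<close> or \<open>p \<le> g + A \<le> p + M\<close>, minus that of
        \<open>1 \<le> g \<le> M + 1\<close>. The first alternative forces \<open>g \<le> M\<close>,
        so only the wrapped interval needs the divisibility.\<close>
      have "g \<le> M + 1" if "p \<le> g + A" "g + A \<le> p + M"
        using that d dvd_small[of "g + A + B - M - p"] M A B(1,2) g c f_pos by (smt (verit) dvd_diff_left_iff dvd_refl)
      thus ?thesis using R(1) c g1 M A g f_pos p_gt_1 unfolding R_def[symmetric] by (smt (verit) of_bool_def)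
    qed
  qed
  show "row E \<tau> u \<le> 0" if u: "\<not> p dvd u" "p dvd u - (E + \<tau> - 1)" "p * w - p \<le> E + \<tau> - 1"
  proof -
    have g1: "1 \<le> g" using u(1) p0 g by simp
    have "dv (u - (\<epsilon> + \<tau> - 1) - w * M) = 1" using u(2) by (simp add: dv_def E_eq algebra_simps)
    hence "p dvd g + f * (\<epsilon> + \<tau> - 1) - M" unfolding dv_conv[OF g(1)] by simp
    also have "g + f * (\<epsilon> + \<tau> - 1) - M = g + A + B - f - M" by (simp add: A_def B_def algebra_simps)
    finally have d: "p dvd g + A + B - f - M" .
    consider "\<epsilon> = 0" | "0 < \<epsilon>" "\<tau> + \<epsilon> < w" | "\<tau> + \<epsilon> = w" | "w < \<tau> + \<epsilon>" using \<epsilon> by linarith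
    thus ?thesis
    proof cases
      case 1
      hence "C = A" "B = 0" using C1 B t by auto
      moreover have "g + A = M + f \<or> g + A = M + f + p"
        using d dvd_small[of "g + A + B - f - M"] M A g \<open>B = 0\<close> f_pos by (smt (verit))
      ultimately show ?thesis using R(1) g1 M A f_pos g p_gt_1 unfolding R_def[symmetric]
        by (smt (verit) of_bool_def)
    next
      case 2
      \<comment> \<open>The lower bound on \<open>E + \<tau> - 1\<close> enters here: it yields
        \<open>p * y < w * M + y\<close>, hence \<open>f * y < M\<close> because
        \<open>w * f = p - 1\<close>. The residue \<open>g\<close> is then \<open>M - f * y\<close>,
        so the negative indicator of \<open>1 \<le> g \<le> M\<close> is present.\<close>
      define y where "y = \<epsilon> + \<tau> - 1"
      have y: "y < w - 1" using 2 by (simp add: y_def)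
      have fy: "f * y = A + B - f" by (simp add: y_def AB algebra_simps)
      have "p * y < p * (w - 1)" using y p_gt_1 by simp
      hence "p * y + p < p * w" by (simp add: algebra_simps)
      moreover have "p * w - p \<le> w * M + y" using u(3) by (simp add: E_eq y_def)
      moreover have "w * (f * y) = p * y - y" by (simp add: p_eq algebra_simps)
      ultimately have "w * (f * y) < w * M" by linarith
      hence "f * y < M" using w_pos by simp
      hence "A + B - f < M" using fy by simp
      hence "g \<le> M" using d dvd_small[of "g + A + B - f - M"] M M2 A B(1,2) g 2 f_pos C1 by (smt (verit))
      thus ?thesis using R(1) g1 M A g f_pos p_gt_1 unfolding R_def[symmetric] by (smt (verit) of_bool_def)
    next
      case 3
      hence c: "C = p - 1" "A + B = p - 1" "M \<le> p - 2" using C2 C1 M2 t by auto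
      have "w * f = p - 1" using fw by (simp add: mult.commute)
      hence "w * (p - 2 - f) < w * M" using u(3) 3 E_eq w_pos by (simp add: algebra_simps)
      hence "p - 1 - f \<le> M" using w_pos by simp
      hence "g \<le> M + 1" using d dvd_small[of "g + A + B - f - M"] M A B(1,2) g c f_pos by (smt (verit))
      thus ?thesis using R(1) c g1 M A g f_pos p_gt_1 unfolding R_def[symmetric] by (smt (verit) of_bool_def)
    next
      case 4
      hence c: "C = p - 1" "M \<le> p - 2" "p - 1 + f \<le> A + B" using C2 M2 t AB3 by auto
      have "g \<le> M + 1" if "p \<le> g + A" "g + A \<le> p + M"
        using that d dvd_small[of "g + A + B - f - M - p"] M A B(1,2) g c f_pos by (smt (verit) dvd_diff_left_iff dvd_refl)
      thus ?thesis using R(1) c g1 M A g f_pos p_gt_1 unfolding R_def[symmetric] by (smt (verit) of_bool_def)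
    qed
  qed
qed

section \<open>Comparison of the rows for \<open>v\<close> and \<open>v - p\<close>\<close>

definition tau :: "int \<Rightarrow> int" where
  "tau v = xpos v mod (w * p) - (p - 1) * w"

definition rown :: "int \<Rightarrow> int \<Rightarrow> int" where
  "rown I v = rows I (xpos v div (w * p))"

lemma xpos_shift: "xpos (v - p) = (if p \<le> xpos v then xpos v - p else xpos v - p + q)"
proof -
  have "xpos (v - p) = (xpos v - p) mod q"
    unfolding xpos_def mod_diff_left_eq by (simp add: algebra_simps)
  also have "\<dots> = (if p \<le> xpos v then xpos v - p else xpos v - p + q)"
  proof -
    have "xpos v < q" using xpos_bounds(2)[of v] by (simp add: q_eq mult_ac)
    moreover have "(xpos v - p) mod q = (xpos v - p + q) mod q" by simp
    moreover have "(xpos v - p + q) mod q = xpos v - p + q" if "\<not> p \<le> xpos v"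
      using that xpos_bounds(1)[of v] p_gt_1 p_less_q by (intro mod_pos_pos_trivial) auto
    moreover have "(xpos v - p) mod q = xpos v - p" if "p \<le> xpos v"
      using that \<open>xpos v < q\<close> p_gt_1 by (intro mod_pos_pos_trivial) auto
    ultimately show ?thesis by metis
  qed
  finally show ?thesis .
qed

lemma rows_bounds:
  assumes "0 \<le> I" "I \<le> (p - 1) * (w * k)" "0 \<le> a" "a < k"
  shows "0 \<le> rows I a" "rows I a \<le> (p - 1) * w"
proof -
  show "0 \<le> rows I a" using assms k_pos by (simp add: rows_def pos_imp_zdiv_nonneg_iff)
  have "\<not> (p - 1) * w < rows I a" unfolding less_rows_iff using assms by (simp add: algebra_simps)
  thus "rows I a \<le> (p - 1) * w" by simp
qed

lemma tau_less: "tau v < w"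
  using pos_mod_bound[OF wp_pos, of "xpos v"] by (simp add: tau_def algebra_simps)

lemma H_eq_row':
  assumes "I \<le> (p - 1) * (w * k)" "xpos v < w * p * k"
  shows "H I u v = row (rown I v) (tau v) u"
  using H_eq_row[OF assms] by (simp add: rown_def tau_def)

lemma abs_row_le_1:
  assumes "0 \<le> E" "E \<le> (p - 1) * w" "\<tau> < w"
  shows "\<bar>row E \<tau> u\<bar> \<le> 1"
proof (cases "\<tau> \<le> 0")
  case True thus ?thesis using row_nonpos[OF True assms(1), of u] by (auto simp: dv_def)
next
  case False thus ?thesis using row_pos_bounds(1)[of \<tau> E u] assms by simp
qed

lemma abs_H_le_1:
  assumes "0 \<le> I" "I \<le> (p - 1) * (w * k)"
  shows "\<bar>H I u v\<bar> \<le> 1"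
proof (cases "xpos v < w * p * k")
  case True
  thus ?thesis unfolding H_eq_row'[OF assms(2) True] rown_def
    using rows_bounds[OF assms xpos_div_bounds[OF True]] tau_less by (intro abs_row_le_1) auto
next
  case False
  thus ?thesis using H_hole[OF assms(2)] by simp
qed

lemma rows_antimono: "a \<le> b \<Longrightarrow> rows I b \<le> rows I a"
  unfolding rows_def using k_pos by (intro zdiv_mono1) auto

lemma rows_add: "rows I (a + k) = rows I a - 1"
proof -
  have "rows I (a + k) = (I - a + k - 1 + (- 1) * k) div k"
    unfolding rows_def by (rule arg_cong[of _ _ "\<lambda>z. z div k"]) simp
  also have "\<dots> = - 1 + rows I a" unfolding rows_def using k_pos by (intro div_mult_self1) simp
  finally show ?thesis by simp
qed

text \<open>The row with \<open>\<tau> \<le> 0\<close> is 1 only if \<open>p dvd u\<close>, and -1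
  only if \<open>p dvd u - (E + \<tau>)\<close>. The hypothesis \<open>rel\<close> links the ends of
  the two rows modulo \<open>p\<close>, up to a shift by one, so \<open>row_pos_bounds\<close> rules
  out opposite signs.\<close>

lemma mixed_rows:
  assumes neg: "\<tau> \<le> 0" "0 \<le> E" and pos: "0 < \<tau>'" "\<tau>' < w" "0 \<le> E'" "E' \<le> (p - 1) * w"
    and rel: "p dvd E + \<tau> - (E' + \<tau>') \<or> p dvd E + \<tau> - (E' + \<tau>' - 1) \<and> (0 \<le> E + \<tau> \<longrightarrow> p * w - p \<le> E' + \<tau>' - 1)"
  shows "\<bar>row E' \<tau>' u - row E \<tau> u\<bar> \<le> 1"
proof -
  note b = row_pos_bounds[OF pos, of u]
  have n: "row E \<tau> u = dv u - dv (u - max 0 (E + \<tau>))" by (rule row_nonpos[OF neg])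
  show ?thesis
  proof (cases "p dvd u")
    case True
    thus ?thesis using b(1,2) n by (auto simp: dv_def)
  next
    case False
    show ?thesis
    proof (cases "0 \<le> E + \<tau> \<and> p dvd u - (E + \<tau>)")
      case True
      have "row E' \<tau>' u \<le> 0"
        using rel
      proof
        assume "p dvd E + \<tau> - (E' + \<tau>')"
        hence "p dvd (u - (E + \<tau>)) + (E + \<tau> - (E' + \<tau>'))" using True by (intro dvd_add) auto
        thus ?thesis using b(3)[OF False] by (simp add: algebra_simps)
      next
        assume *: "p dvd E + \<tau> - (E' + \<tau>' - 1) \<and> (0 \<le> E + \<tau> \<longrightarrow> p * w - p \<le> E' + \<tau>' - 1)"
        hence "p dvd (u - (E + \<tau>)) + (E + \<tau> - (E' + \<tau>' - 1))" using True by (intro dvd_add) auto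
        hence "p dvd u - (E' + \<tau>' - 1)" by (simp add: algebra_simps)
        thus ?thesis using b(4)[OF False] * True by blast
      qed
      thus ?thesis using b(1) n False True by (auto simp: dv_def)
    next
      case F: False
      hence "row E \<tau> u = 0" using n False by (auto simp: dv_def max_def)
      thus ?thesis using b(1) by simp
    qed
  qed
qed

text \<open>Both rows start with the same \<open>dv u\<close>, which cancels and leaves a difference
  of two indicators.\<close>

lemma nonpos_rows:
  assumes "\<tau> \<le> 0" "0 \<le> E" "\<tau>' \<le> 0" "0 \<le> E'"
  shows "\<bar>row E' \<tau>' u - row E \<tau> u\<bar> \<le> 1"
  unfolding row_nonpos[OF assms(1,2)] row_nonpos[OF assms(3,4)] by (auto simp: dv_def)

text \<open>Replacing \<open>v\<close> by \<open>v - p\<close> lowers \<open>xpos\<close> by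
  \<open>p\<close> modulo \<open>q\<close>. Either the remainder \<open>y\<close> absorbs this, or
  the quotient \<open>a\<close> drops by one, or, for \<open>a = 0\<close>, the value wraps around
  to the top quotient \<open>k - 1\<close>. In every case at least one of the two offsets is
  nonpositive, and the row ends are related as \<open>mixed_rows\<close> requires.\<close>

lemma abs_H_diff_le_1:
  assumes I: "0 \<le> I" "I \<le> (p - 1) * (w * k)"
  shows "\<bar>H I u v - H I u (v - p)\<bar> \<le> 1"
proof (cases "xpos v < w * p * k \<and> xpos (v - p) < w * p * k")
  case False
  thus ?thesis using H_hole[OF I(2)] abs_H_le_1[OF I] by (metis abs_minus_commute diff_0_right)
next
  case True
  define x y a where "x = xpos v" and "y = x mod (w * p)" and "a = x div (w * p)"
  define x' y' a' where "x' = xpos (v - p)" and "y' = x' mod (w * p)" and "a' = x' div (w * p)"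
  have xk: "x < w * p * k" "x' < w * p * k" using True by (simp_all add: x_def x'_def)
  have x_eq: "x = w * p * a + y" by (simp add: a_def y_def)
  have y: "0 \<le> y" "y < w * p" using wp_pos by (simp_all add: y_def)
  have wp: "p \<le> w * p" using w_pos p_gt_1 mult_right_mono[of 1 w p] by simp
  have a: "0 \<le> a" "a < k" "0 \<le> a'" "a' < k"
    using True xpos_div_bounds by (simp_all add: a_def a'_def x_def x'_def)
  have E: "0 \<le> rows I a" "0 \<le> rows I a'" "rows I a \<le> (p - 1) * w" "rows I a' \<le> (p - 1) * w"
    using rows_bounds[OF I] a by auto
  have H: "H I u v = row (rows I a) (y - (p - 1) * w) u" "H I u (v - p) = row (rows I a') (y' - (p - 1) * w) u"
    using True H_eq_row'[OF I(2)] by (simp_all add: rown_def tau_def x_def x'_def y_def y'_def a_def a'_def)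
  have yl: "y - (p - 1) * w < w" "y' - (p - 1) * w < w"
    using tau_less[of v] tau_less[of "v - p"] by (simp_all add: tau_def y_def y'_def x_def x'_def)
  have pw: "p - 1 \<le> (p - 1) * w" using w_pos p_gt_1 mult_left_mono[of 1 w "p - 1"] by simp
  note xs = xpos_shift[of v, folded x_def x'_def]
  consider (1) "p \<le> y" | (2) "y < p" "1 \<le> a" | (3) "y < p" "a = 0" using a by linarith
  thus ?thesis
  proof cases
    case 1
    have "w * p * a \<ge> 0" using wp_pos a by simp
    hence "x' = w * p * a + (y - p)" using xs x_eq 1 by simp
    hence s: "y' = y - p" "a' = a" using 1 y p_gt_1 by (simp_all add: y'_def a'_def block_div_mod)
    have n': "y' - (p - 1) * w \<le> 0" using s yl w_less_p by simp
    show ?thesis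
    proof (cases "y - (p - 1) * w \<le> 0")
      case True
      show ?thesis unfolding H using nonpos_rows[OF n' E(2) True E(1)] by simp
    next
      case False
      have "p dvd rows I a' + (y' - (p - 1) * w) - (rows I a + (y - (p - 1) * w))" using s by simp
      thus ?thesis unfolding H using mixed_rows[OF n' E(2) _ yl(1) E(1) E(3)] False by simp
    qed
  next
    case 2
    have "w * p * 1 \<le> w * p * a" using wp_pos 2 by (intro mult_left_mono) auto
    hence "x' = x - p" using xs x_eq y wp by simp
    hence "x' = w * p * (a - 1) + (y - p + w * p)" using x_eq by (simp add: algebra_simps)
    hence s: "y' = y - p + w * p" "a' = a - 1" using 2 y wp by (simp_all only: y'_def a'_def block_div_mod)
    have n: "y - (p - 1) * w \<le> 0" using 2 pw by linarith
    \<comment> \<open>\<open>rows\<close> is antitone and falls by exactly one over a distance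
      \<open>k\<close>, so a shorter distance changes it by 0 or 1.\<close>
    have r: "rows I a' = rows I a \<or> rows I a' = rows I a + 1"
      using rows_antimono[of a' a I] rows_antimono[of a "a' + k" I] rows_add[of I a'] s k_pos by auto
    show ?thesis
    proof (cases "y' - (p - 1) * w \<le> 0")
      case True
      show ?thesis unfolding H using nonpos_rows[OF True E(2) n E(1)] by simp
    next
      case False
      show ?thesis unfolding H abs_minus_commute[of "row (rows I a) _ u"]
      proof (rule mixed_rows[OF n E(1) _ yl(2) E(2) E(4)])
        show "p dvd rows I a + (y - (p - 1) * w) - (rows I a' + (y' - (p - 1) * w)) \<or>
          p dvd rows I a + (y - (p - 1) * w) - (rows I a' + (y' - (p - 1) * w) - 1) \<and>
          (0 \<le> rows I a + (y - (p - 1) * w) \<longrightarrow> p * w - p \<le> rows I a' + (y' - (p - 1) * w) - 1)"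
          using r
        proof
          assume "rows I a' = rows I a"
          hence "rows I a + (y - (p - 1) * w) - (rows I a' + (y' - (p - 1) * w)) = p * (1 - w)"
            by (simp add: s algebra_simps)
          thus ?thesis by simp
        next
          assume r: "rows I a' = rows I a + 1"
          hence "rows I a + (y - (p - 1) * w) - (rows I a' + (y' - (p - 1) * w) - 1) = p * (1 - w)"
            by (simp add: s algebra_simps)
          thus ?thesis using r s by (simp add: mult.commute)
        qed
      qed (use False in simp)
    qed
  next
    case 3
    have x: "x = y" using x_eq 3 by simp
    hence "x' = x - p + q" using xs 3 by simp
    hence x'_eq: "x' = w * p * (k - 1) + (y - p + 1 + w * p)"
      using x by (simp add: q_eq algebra_simps)
    \<comment> \<open>Equality would put \<open>x'\<close> at the hole \<open>w * p * k\<close>.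
      Excluding it makes the new remainder smaller than \<open>w * p\<close>.\<close>
    moreover have "y - p + 1 \<noteq> 0" using xk(2) x'_eq by (auto simp: algebra_simps)
    ultimately have s: "y' = y - p + 1 + w * p" "a' = k - 1"
      using 3 y wp by (simp_all only: y'_def a'_def block_div_mod)
    have n: "y - (p - 1) * w \<le> 0" using 3 pw by linarith
    have r: "rows I a' = rows I a \<or> rows I a' = rows I a - 1"
      using rows_antimono[of a' "a + k" I] rows_antimono[of a "a'" I] rows_add[of I a] s k_pos 3 by auto
    show ?thesis
    proof (cases "y' - (p - 1) * w \<le> 0")
      case True
      show ?thesis unfolding H using nonpos_rows[OF True E(2) n E(1)] by simp
    next
      case False
      show ?thesis unfolding H abs_minus_commute[of "row (rows I a) _ u"]
      proof (rule mixed_rows[OF n E(1) _ yl(2) E(2) E(4)])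
        show "p dvd rows I a + (y - (p - 1) * w) - (rows I a' + (y' - (p - 1) * w)) \<or>
          p dvd rows I a + (y - (p - 1) * w) - (rows I a' + (y' - (p - 1) * w) - 1) \<and>
          (0 \<le> rows I a + (y - (p - 1) * w) \<longrightarrow> p * w - p \<le> rows I a' + (y' - (p - 1) * w) - 1)"
          using r
        proof
          assume r: "rows I a' = rows I a"
          hence "rows I a + (y - (p - 1) * w) - (rows I a' + (y' - (p - 1) * w) - 1) = p * (1 - w)"
            by (simp add: s algebra_simps)
          thus ?thesis using r s by (simp add: mult.commute)
        next
          assume "rows I a' = rows I a - 1"
          hence "rows I a + (y - (p - 1) * w) - (rows I a' + (y' - (p - 1) * w)) = p * (1 - w)"
            by (simp add: s algebra_simps)
          thus ?thesis by simp
        qed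
      qed (use False in simp)
    qed
  qed
qed

lemma abs_S_le_1:
  assumes "0 \<le> I" "I \<le> (p - 1) * (w * k)"
  shows "\<bar>S I t\<bar> \<le> 1"
  unfolding S_eq_H by (rule abs_H_diff_le_1[OF assms])

section \<open>The full sum vanishes, and prefixes can be reversed\<close>

lemma sum_dv_full: "(\<Sum>m\<in>{0..<p}. dv (u - w * m)) = 1"
proof -
  obtain g where g: "p dvd u - w * g" "0 \<le> g" "g < p" using ex_residue by blast
  have "(\<Sum>m\<in>{0..<p}. dv (u - 0 - w * m)) = (\<Sum>m\<in>{0..<p}. of_bool (p dvd g + f * 0 - m))"
    unfolding dv_conv[OF g(1)] ..
  also have "\<dots> = 1" using count_dvd[of g p] g p_gt_1 by simp
  finally show ?thesis by simp
qed

text \<open>With all pairs present every \<open>a\<close> has exactly \<open>(p - 1) * w\<close>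
  rows. For a positive offset there are \<open>p - 1\<close> complete blocks, so each sum of
  \<open>dv\<close> runs over all residues modulo \<open>p\<close> but one. In both cases the row
  ends at \<open>u - y\<close>, and \<open>y\<close> agrees with \<open>xpos v\<close> modulo
  \<open>p\<close>.\<close>

lemma H_full: "H ((p - 1) * (w * k)) u v = dv u - dv (u - xpos v)"
proof (cases "xpos v < w * p * k")
  case False
  hence "xpos v = p * (w * k)" using xpos_bounds(2)[of v] by simp
  thus ?thesis using H_hole[OF order_refl False] dv_add_mult(1) by simp
next
  case True
  define a y E where "a = xpos v div (w * p)" and "y = xpos v mod (w * p)" and "E = (p - 1) * w"
  have a: "0 \<le> a" "a < k" using xpos_div_bounds[OF True] by (simp_all add: a_def)
  have y: "0 \<le> y" "y < w * p" using wp_pos by (simp_all add: y_def)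
  have E0: "0 \<le> E" using p_gt_1 w_pos by (simp add: E_def)
  have "e < rows ((p - 1) * (w * k)) a \<longleftrightarrow> e < E" for e
  proof -
    have "k * e + a < k * E \<longleftrightarrow> e < E"
    proof
      assume "k * e + a < k * E"
      hence "k * e < k * E" using a by linarith
      thus "e < E" using k_pos by simp
    next
      assume "e < E"
      hence "k * (e + 1) \<le> k * E" using k_pos by (intro mult_left_mono) auto
      thus "k * e + a < k * E" using a by (simp add: algebra_simps)
    qed
    thus ?thesis by (simp add: less_rows_iff E_def mult_ac)
  qed
  hence rE: "rows ((p - 1) * (w * k)) a = E" by (metis less_irrefl linorder_neqE)
  have "H ((p - 1) * (w * k)) u v = row E (y - E) u"
    using H_eq_row[OF order_refl True] rE by (simp add: a_def y_def E_def)
  also have "\<dots> = dv u - dv (u - y)"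
  proof (cases "y \<le> E")
    case True
    thus ?thesis using row_nonpos[of "y - E" E u] E0 y by simp
  next
    case False
    define \<tau> where "\<tau> = y - E"
    have t: "0 < \<tau>" "\<tau> < w" using False y by (simp_all add: \<tau>_def E_def algebra_simps)
    have E: "E div w = p - 1" "E mod w = 0" using w_pos by (simp_all add: E_def)
    have last: "(\<Sum>m\<in>{0..<p - 1}. dv (z - w * m)) = 1 - dv (z - w * (p - 1))" for z
      using sum_dv_full[of z] sum_int_step[of "p - 1" "\<lambda>m. dv (z - w * m)"] p_gt_1 by simp
    have "row E \<tau> u = (1 - dv (u - \<tau> - w * (p - 1))) - (1 - dv (u - w - w * (p - 1)))"
      using row_pos_closed[OF t E0, of u] t unfolding E sum_subtractf last by simp
    also have "u - w - w * (p - 1) = u - w * p" by (simp add: algebra_simps)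
    also have "u - \<tau> - w * (p - 1) = u - y" by (simp add: \<tau>_def E_def algebra_simps)
    finally show ?thesis by (simp add: \<tau>_def dv_add_mult)
  qed
  also have "dv (u - y) = dv (u - xpos v)"
  proof -
    have "u - xpos v = u - y - p * (w * a)"
      using mult_div_mod_eq[of "w * p" "xpos v"] by (simp add: a_def y_def algebra_simps)
    thus ?thesis by (simp only: dv_add_mult)
  qed
  finally show ?thesis .
qed

lemma dv_minus_q: "dv (x - q) = dv (x - 1)"
proof -
  have "x - q = x - 1 - p * (w * k)" by (simp add: q_eq mult_ac)
  thus ?thesis by (simp only: dv_add_mult)
qed

text \<open>Since \<open>p < q\<close>, the only index that can contribute is
  \<open>i = t mod q\<close>.\<close>

lemma chi_eq: "chi t = (if t mod q < p then dv (t - t mod q) - dv (t - 1 - t mod q) else 0)"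
proof -
  have q0: "0 < q" using p_less_q p_gt_1 by simp
  have *: "q dvd t - i \<longleftrightarrow> i = t mod q" "q dvd t - q - i \<longleftrightarrow> i = t mod q" if "i \<in> {0..<p}" for i
  proof -
    have "q dvd t - i \<longleftrightarrow> t mod q = i mod q" by (simp add: mod_eq_dvd_iff)
    also have "i mod q = i" using that p_less_q by simp
    finally show "q dvd t - i \<longleftrightarrow> i = t mod q" by auto
    moreover have "q dvd t - q - i \<longleftrightarrow> q dvd t - i"
      using dvd_diff_left_iff[of q q "t - i"] by (simp add: algebra_simps)
    ultimately show "q dvd t - q - i \<longleftrightarrow> i = t mod q" by simp
  qed
  have "chi t = (\<Sum>i\<in>{0..<p}. if i = t mod q then dv (t - i) - dv (t - q - i) else 0)"
    unfolding chi_def pq_dvd_iff by (intro sum.cong refl) (auto simp: * dv_def)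
  also have "\<dots> = (if t mod q < p then dv (t - t mod q) - dv (t - q - t mod q) else 0)"
    using q0 by (subst sum.delta) auto
  also have "dv (t - q - t mod q) = dv (t - 1 - t mod q)"
    using dv_minus_q[of "t - t mod q"] by (simp add: algebra_simps)
  finally show ?thesis .
qed

text \<open>By \<open>H_full\<close> the pairs contribute
  \<open>dv (t - xpos (t - p)) - dv (t - xpos t)\<close>. This is 0 unless
  \<open>xpos t < p\<close>, when the shift wraps around modulo \<open>q\<close>. The argument of
  the last \<open>chi\<close> is \<open>xpos t\<close> modulo \<open>q\<close>, so by
  \<open>chi_eq\<close> it cancels the pairs in both cases.\<close>

lemma S_full: "S ((p - 1) * (w * k)) t + chi (t - w * ((p - 1) * (w * k)) * p) = 0"
proof -
  have e: "t - w * ((p - 1) * (w * k)) * p = t + (p - 1) * w - q * (w * (p - 1))"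
    by (simp add: q_eq algebra_simps)
  have m: "(t - w * ((p - 1) * (w * k)) * p) mod q = xpos t"
    unfolding e xpos_def by (metis mod_diff_cong mod_mult_self1_is_0 diff_zero mod_mod_trivial)
  have d: "dv (t - w * ((p - 1) * (w * k)) * p - z) = dv (t - z)" for z
    using dv_add_mult(2)[of "t - z" "w * ((p - 1) * (w * k))"] by (simp add: algebra_simps)
  have d1: "dv (t - w * ((p - 1) * (w * k)) * p - 1 - z) = dv (t - 1 - z)" for z
    using d[of "1 + z"] by (simp add: algebra_simps)
  have dp: "dv (t - (z - p)) = dv (t - z)" "dv (t - (z - p + q)) = dv (t - 1 - z)" for z
    using dv_add_mult(2)[of "t - z + p" 1] dv_minus_q[of "t - z + p"] dv_add_mult(2)[of "t - z + p - 1" 1]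
    by (simp_all add: algebra_simps)
  show ?thesis
    unfolding S_eq_H H_full chi_eq m d d1 xpos_shift by (simp add: dp)
qed

text \<open>The numerator \<open>(1 + x + ... + x^(p-1)) (1 - x^q)\<close> has degree
  \<open>p + q - 1\<close> and is antipalindromic.\<close>

lemma chi_reflect: "chi (p + q - 1 - t) = - chi t"
proof -
  have d: "p * q dvd a \<longleftrightarrow> p * q dvd b" if "a = - b" for a b using that by simp
  have "chi (p + q - 1 - t) =
      (\<Sum>i\<in>{0..<p}. of_bool (p * q dvd t - q - i) - of_bool (p * q dvd t - i))"
    unfolding chi_def
  proof (rule sum.reindex_bij_witness[of _ "\<lambda>i. p - 1 - i" "\<lambda>i. p - 1 - i"])
    fix i
    show "of_bool (p * q dvd t - q - (p - 1 - i)) - of_bool (p * q dvd t - (p - 1 - i)) =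
      of_bool (p * q dvd p + q - 1 - t - i) - (of_bool (p * q dvd p + q - 1 - t - q - i) :: int)"
      using d[of "t - q - (p - 1 - i)" "p + q - 1 - t - i"]
        d[of "t - (p - 1 - i)" "p + q - 1 - t - q - i"] by simp
  qed auto
  thus ?thesis unfolding chi_def by (simp only: sum_subtractf)
qed

lemma S_step:
  assumes "0 \<le> I"
  shows "S (I + 1) t = S I t + (chi (t - w * I * p) - chi (t - w * (I * p + 1 + I div (w * k))))"
  unfolding S_def using assms by (rule sum_int_step)

text \<open>A prefix ending in an unpaired positive power is minus the remaining terms, because the
  full sum is 0. Read backwards, those terms are again complete pairs, and
  \<open>chi_reflect\<close> supplies the second minus sign.\<close>

lemma S_reverse:
  assumes "0 \<le> n" "n \<le> (p - 1) * (w * k)"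
  defines "L \<equiv> (p - 1) * (w * k)"
  shows "S (L - n) t + chi (t - w * (L - n) * p) = S n (p + q - 1 - (t - w * L * p))"
  using assms(1,2)
proof (induction n rule: int_ge_induct)
  case base
  show ?case using S_full[of t] by (simp add: L_def S_def)
next
  case (step n)
  define l where "l = w * k"
  define j where "j = L - (n + 1)"
  have l: "0 < l" using w_pos k_pos by (simp add: l_def)
  have n: "0 \<le> n" "n < L" using step by (simp_all add: L_def)
  \<comment> \<open>Reversal sends block \<open>m\<close> of the \<open>p - 1\<close> blocks of
    length \<open>l\<close> to block \<open>p - 2 - m\<close>.\<close>
  have jdiv: "j div l = p - 2 - n div l"
  proof -
    have "j = l * (p - 2 - n div l) + (l - 1 - n mod l)"
      using mult_div_mod_eq[of l n] by (simp add: j_def L_def l_def algebra_simps)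
    moreover have "0 \<le> l - 1 - n mod l" "l - 1 - n mod l < l"
      using pos_mod_bound[OF l, of n] pos_mod_sign[OF l, of n] by linarith+
    ultimately show ?thesis using block_div_mod(1) by simp
  qed
  let ?z = "p + q - 1 - (t - w * L * p)"
  have c1: "chi (?z - w * n * p) = - chi (t - w * (L - n) * p)"
    using chi_reflect[of "t - w * (L - n) * p"] by (simp add: algebra_simps)
  have "?z - w * (n * p + 1 + n div l) = p + q - 1 - (t - w * (j * p + 1 + j div l))"
    unfolding jdiv by (simp add: j_def algebra_simps)
  hence c2: "chi (?z - w * (n * p + 1 + n div l)) = - chi (t - w * (j * p + 1 + j div l))"
    by (simp only: chi_reflect)
  have "S (j + 1) t = S j t + (chi (t - w * j * p) - chi (t - w * (j * p + 1 + j div l)))"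
    unfolding l_def by (rule S_step) (use n in \<open>simp add: j_def\<close>)
  moreover have "S (n + 1) ?z = S n ?z + (chi (?z - w * n * p) - chi (?z - w * (n * p + 1 + n div l)))"
    unfolding l_def by (rule S_step) (use n in simp)
  moreover have "S (L - n) t + chi (t - w * (L - n) * p) = S n ?z"
    using step by (simp add: L_def)
  moreover have "j + 1 = L - n" by (simp add: j_def)
  ultimately show ?case unfolding j_def[symmetric] using c1 c2 by simp
qed

lemma abs_S_chi_le_1:
  assumes "0 \<le> I" "I \<le> (p - 1) * (w * k)"
  shows "\<bar>S I t + chi (t - w * I * p)\<bar> \<le> 1"
  using S_reverse[of "(p - 1) * (w * k) - I" t] abs_S_le_1[of "(p - 1) * (w * k) - I"] assms by simp

section \<open>Prefixes cut off at an arbitrary exponent\<close>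

lemma sum_if_less:
  fixes g :: "int \<Rightarrow> int"
  assumes "\<And>i. i \<in> {0..<n} \<Longrightarrow> Q i \<longleftrightarrow> i < m" "m \<le> n"
  shows "(\<Sum>i\<in>{0..<n}. if Q i then g i else 0) = (\<Sum>i\<in>{0..<m}. g i)"
proof -
  have "(\<Sum>i\<in>{0..<n}. if Q i then g i else 0) = (\<Sum>i\<in>{0..<n}. if i < m then g i else 0)"
    using assms by (intro sum.cong) auto
  also have "\<dots> = (\<Sum>i\<in>{i\<in>{0..<n}. i < m}. g i)" by (intro sum.inter_filter[symmetric]) simp
  also have "{i\<in>{0..<n}. i < m} = {0..<m}" using assms(2) by auto
  finally show ?thesis .
qed

text \<open>As \<open>i div (w * k) \<le> p - 2\<close>, the negative exponent of pair
  \<open>i\<close> lies strictly between \<open>i * p\<close> and \<open>(i + 1) * p\<close>. A cut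
  at \<open>J\<close> therefore leaves complete pairs and at most one unpaired positive
  power.\<close>

lemma abs_prefix_le_1:
  assumes J: "0 \<le> J"
  defines "L \<equiv> (p - 1) * (w * k)"
  shows "\<bar>(\<Sum>i\<in>{0..<L + 1}. if i * p \<le> J then chi (t - w * (i * p)) else 0) -
    (\<Sum>i\<in>{0..<L}. if i * p + 1 + i div (w * k) \<le> J then chi (t - w * (i * p + 1 + i div (w * k))) else 0)\<bar> \<le> 1"
    (is "\<bar>?A - ?B\<bar> \<le> 1")
proof -
  define N where "N = J div p"
  have p0: "0 < p" using p_gt_1 by simp
  have N0: "0 \<le> N" using J p0 by (simp add: N_def pos_imp_zdiv_nonneg_iff)
  have N: "N * p \<le> J" "J < (N + 1) * p"
  proof -
    have "J = N * p + J mod p" by (simp add: N_def)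
    thus "N * p \<le> J" "J < (N + 1) * p"
      using pos_mod_bound[OF p0, of J] pos_mod_sign[OF p0, of J] unfolding distrib_right by linarith+
  qed
  have L0: "0 \<le> L" using p_gt_1 w_pos k_pos by (simp add: L_def)
  have div_le: "0 \<le> i div (w * k)" "i div (w * k) \<le> p - 2" if "0 \<le> i" "i < L" for i
  proof -
    have l: "0 < w * k" using w_pos k_pos by simp
    show "0 \<le> i div (w * k)" using that l by (simp add: pos_imp_zdiv_nonneg_iff)
    have "w * k * (i div (w * k)) \<le> i"
      using pos_mod_sign[OF l, of i] mult_div_mod_eq[of "w * k" i] by linarith
    hence "w * k * (i div (w * k)) < w * k * (p - 1)" using that by (simp add: L_def mult.commute)
    thus "i div (w * k) \<le> p - 2" using l mult_less_cancel_left_pos[of "w * k"] by simp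
  qed
  have le_iff: "i * p \<le> J \<longleftrightarrow> i \<le> N" for i
  proof
    assume "i * p \<le> J"
    hence "i * p < (N + 1) * p" using N by linarith
    thus "i \<le> N" using p0 by simp
  next
    assume "i \<le> N"
    hence "i * p \<le> N * p" using p0 by simp
    thus "i * p \<le> J" using N by linarith
  qed
  have minus_lt: "i * p + 1 + i div (w * k) \<le> J" if "0 \<le> i" "i < L" "i < N" for i
  proof -
    have "(i + 1) * p \<le> J" using that le_iff by simp
    thus ?thesis using div_le[of i] that by (simp add: algebra_simps)
  qed
  have minus_gt: "\<not> i * p + 1 + i div (w * k) \<le> J" if "0 \<le> i" "i < L" "N < i" for i
    using le_iff[of i] that div_le[of i] by linarith
  have S_eq: "S I t = (\<Sum>i\<in>{0..<I}. chi (t - w * (i * p))) -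
      (\<Sum>i\<in>{0..<I}. chi (t - w * (i * p + 1 + i div (w * k))))" for I
    by (simp add: S_def sum_subtractf mult.assoc)
  consider "L \<le> N" | "N < L" "N * p + 1 + N div (w * k) \<le> J" | "N < L" "\<not> N * p + 1 + N div (w * k) \<le> J"
    by linarith
  thus ?thesis
  proof cases
    case 1
    have "?A = (\<Sum>i\<in>{0..<L + 1}. chi (t - w * (i * p)))"
      using 1 by (intro sum_if_less) (auto simp: le_iff)
    moreover have "?B = (\<Sum>i\<in>{0..<L}. chi (t - w * (i * p + 1 + i div (w * k))))"
      using 1 minus_lt by (intro sum_if_less) auto
    ultimately have "?A - ?B = S L t + chi (t - w * L * p)"
      using L0 by (simp add: S_eq sum_int_step mult.assoc)
    thus ?thesis using abs_S_chi_le_1[of L t] L0 by (simp add: L_def)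
  next
    case 2
    have "?A = (\<Sum>i\<in>{0..<N + 1}. chi (t - w * (i * p)))"
      using 2 by (intro sum_if_less) (auto simp: le_iff)
    moreover have "?B = (\<Sum>i\<in>{0..<N + 1}. chi (t - w * (i * p + 1 + i div (w * k))))"
    proof (intro sum_if_less)
      fix i assume "i \<in> {0..<L}"
      thus "i * p + 1 + i div (w * k) \<le> J \<longleftrightarrow> i < N + 1"
        using minus_lt[of i] minus_gt[of i] 2 by (cases i N rule: linorder_cases) auto
    qed (use 2 in simp)
    ultimately have "?A - ?B = S (N + 1) t" by (simp add: S_eq)
    thus ?thesis using abs_S_le_1[of "N + 1" t] 2 N0 by (simp add: L_def)
  next
    case 3
    have "?A = (\<Sum>i\<in>{0..<N + 1}. chi (t - w * (i * p)))"
      using 3 by (intro sum_if_less) (auto simp: le_iff)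
    moreover have "?B = (\<Sum>i\<in>{0..<N}. chi (t - w * (i * p + 1 + i div (w * k))))"
    proof (intro sum_if_less)
      fix i assume "i \<in> {0..<L}"
      thus "i * p + 1 + i div (w * k) \<le> J \<longleftrightarrow> i < N"
        using minus_lt[of i] minus_gt[of i] 3 by (cases i N rule: linorder_cases) auto
    qed (use 3 in simp)
    ultimately have "?A - ?B = S N t + chi (t - w * N * p)"
      using N0 by (simp add: S_eq sum_int_step mult.assoc)
    thus ?thesis using abs_S_chi_le_1[of N t] 3 N0 by (simp add: L_def)
  qed
qed

section \<open>From \<open>chi\<close> to the coefficients and the height\<close>

lemma chi_periodic: "chi (t - p * q * z) = chi t"
proof -
  have d: "p * q dvd x - p * q * z \<longleftrightarrow> p * q dvd x" for x
    by (metis dvd_diff_left_iff dvd_triv_left)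
  have "t - p * q * z - i = t - i - p * q * z" "t - p * q * z - q - i = t - q - i - p * q * z" for i
    by simp_all
  thus ?thesis unfolding chi_def by (simp only: d)
qed

text \<open>\<open>D\<close> is the geometric series in \<open>x^(PQ)\<close>, and
  \<open>chi\<close> sums its shifts by \<open>i\<close> and \<open>Q + i\<close>. All shifts are
  below \<open>P * Q\<close>, so in degrees below the shift the periodic indicator is 0, as the
  series coefficient is.\<close>

lemma chi_series:
  assumes P: "p = int P" and Q: "q = int Q"
  shows "Abs_fps (\<lambda>n. of_int (chi (int n))) * ((1 - fps_X) * (1 - fps_X ^ (P * Q))) =
    (1 - fps_X ^ P) * (1 - fps_X ^ Q :: 'a::comm_ring_1 fps)"
proof -
  define D where "D = (Abs_fps (\<lambda>n. of_bool (P * Q dvd n)) :: 'a fps)"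
  have PQ: "1 < P" "P < Q" using P Q p_gt_1 p_less_q by simp_all
  have N: "0 < P * Q" using PQ by simp
  have coeff_D: "(fps_X ^ j * D) $ n = of_bool (p * q dvd int n - int j)" if "j < P * Q" for j n
  proof (cases "j \<le> n")
    case True
    hence "p * q dvd int n - int j \<longleftrightarrow> P * Q dvd n - j"
      unfolding P Q by (metis int_dvd_int_iff of_nat_diff of_nat_mult)
    thus ?thesis using True by (simp add: D_def fps_X_power_mult_nth)
  next
    case False
    have "\<not> p * q dvd int j - int n"
      using False that unfolding P Q by (intro zdvd_not_zless) (auto simp flip: of_nat_mult)
    hence "\<not> p * q dvd int n - int j" by (metis dvd_minus_iff minus_diff_eq)
    thus ?thesis using False by (simp add: D_def fps_X_power_mult_nth)
  qed
  have "2 * Q \<le> P * Q" using PQ by (intro mult_right_mono) auto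
  hence lt: "i < P * Q" "Q + i < P * Q" if "i < P" for i using that PQ by linarith+
  have "Abs_fps (\<lambda>n. of_int (chi (int n))) = (\<Sum>i<P. fps_X ^ i * D - fps_X ^ (Q + i) * D)"
  proof (rule fps_ext)
    fix n
    have "chi (int n) = (\<Sum>i<P. of_bool (p * q dvd int n - int i) - of_bool (p * q dvd int n - int (Q + i)))"
      unfolding chi_def unfolding P sum_int_nat by (simp only: Q diff_diff_eq of_nat_add)
    thus "Abs_fps (\<lambda>n. of_int (chi (int n))) $ n = (\<Sum>i<P. fps_X ^ i * D - fps_X ^ (Q + i) * D) $ n"
      using lt by (simp add: fps_sum_nth coeff_D del: of_nat_add sum_subtractf sum_of_bool_eq)
  qed
  also have "\<dots> = (\<Sum>i<P. fps_X ^ i) * ((1 - fps_X ^ Q) * D)"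
    unfolding sum_distrib_right by (intro sum.cong refl) (simp add: power_add algebra_simps)
  finally have "Abs_fps (\<lambda>n. of_int (chi (int n))) * ((1 - fps_X) * (1 - fps_X ^ (P * Q))) =
      ((1 - fps_X) * (\<Sum>i<P. fps_X ^ i)) * (1 - fps_X ^ Q) * (D * (1 - fps_X ^ (P * Q)))"
    by (simp only: mult_ac)
  also have "\<dots> = (1 - fps_X ^ P) * (1 - fps_X ^ Q)"
    unfolding D_def fps_indicator_inverse[OF N] one_diff_power_eq[symmetric] by simp
  finally show ?thesis .
qed

end

text \<open>\<open>W\<close> is the inverse of the \<open>pq\<close>-th cyclotomic polynomial. The
  three-prime identity is combined with \<open>semigroup_poly_identity\<close> at the
  \<open>r\<close>-th power of the variable, and the nonzero factors \<open>V\<close> are cancelled.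
  Four sign changes on each side make \<open>V\<close> and \<open>U\<close> interchangeable.\<close>

lemma cyclotomic_poly_series:
  fixes p q r l :: nat and W :: "complex fps"
  assumes pr: "prime p" "prime q" "prime r" and less: "p < q" "q < r" and q: "q = 1 + l * p"
    and W: "W * ((1 - fps_X) * (1 - fps_X ^ (p * q))) = (1 - fps_X ^ p) * (1 - fps_X ^ q)"
  shows "fps_of_poly (cyclotomic_poly (p * q * r)) =
    ((\<Sum>i<(p - 1) * l + 1. fps_X ^ (r * (i * p))) -
     (\<Sum>i<(p - 1) * l. fps_X ^ (r * (i * p + 1 + i div l)))) * W"
    (is "?F = ?P * W")
proof -
  define V where "V = (\<lambda>n. 1 - fps_X ^ n :: complex fps)"
  have V: "fps_of_poly (monom 1 n - 1) = - V n" for n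
    by (simp add: V_def fps_of_poly_diff fps_of_poly_monom)
  have pos: "0 < p" "0 < q" "0 < r" using pr prime_gt_0_nat by auto
  have nz: "V n \<noteq> 0" if "0 < n" for n
  proof -
    have "V n $ 0 = 1" using that by (simp add: V_def)
    thus ?thesis by auto
  qed
  have "fps_of_poly (cyclotomic_poly (p * q * r) * ((monom 1 (p * q) - 1) * (monom 1 (p * r) - 1) *
      (monom 1 (q * r) - 1) * (monom 1 1 - 1))) =
    fps_of_poly ((monom 1 (p * q * r) - 1) * (monom 1 p - 1) * (monom 1 q - 1) * (monom 1 r - 1))"
    using cyclotomic_poly_three_primes[OF pr less] by simp
  hence F: "?F * (V (p * q) * V (p * r) * V (q * r) * V 1) = V (p * q * r) * V p * V q * V r"
    unfolding fps_of_poly_mult V by simp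
  have P: "?P * (V (p * r) * V (q * r)) = V (p * q * r) * V r"
    using semigroup_poly_identity[OF pos(1), of "fps_X ^ r" l] unfolding q[symmetric]
    by (simp only: V_def power_mult[symmetric] mult_ac)
  have W': "W * (V 1 * V (p * q)) = V p * V q" using W by (simp add: V_def)
  have "?F * (V (p * q) * V (p * r) * V (q * r) * V 1) = (V (p * q * r) * V r) * (V p * V q)"
    unfolding F by (simp only: mult_ac)
  also have "\<dots> = (?P * W) * (V (p * q) * V (p * r) * V (q * r) * V 1)"
    unfolding P[symmetric] W'[symmetric] by (simp only: mult_ac)
  finally show ?thesis using nz pos by simp
qed

text \<open>Periodicity turns \<open>chi (n - r * j)\<close> into \<open>chi (n - w * j)\<close>,
  possibly at a negative argument, while the cut-off remains \<open>j \<le> n div r\<close>. This is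
  why \<open>abs_prefix_le_1\<close> treats the cut-off and the argument as independent.\<close>

lemma norm_coeff_cyclotomic_poly_le_1:
  fixes p q r w :: nat
  assumes pr: "prime p" "prime q" "prime r" and less: "p < q" "q < r" and w: "w > 0"
    and cong: "[r = w] (mod (p * q))" "[p = 1] (mod w)" "[q = 1] (mod (p * w))"
  shows "cmod (coeff (cyclotomic_poly (p * q * r)) n) \<le> 1"
proof -
  have gt1: "1 < p" "1 < q" using pr prime_gt_1_nat by auto
  obtain f where "p - 1 = w * f" using cong_to_1_nat[OF cong(2)] by blast
  hence f: "p = 1 + w * f" using gt1 by simp
  obtain k where "q - 1 = p * w * k" using cong_to_1_nat[OF cong(3)] by blast
  hence k: "q = 1 + p * w * k" using gt1 by simp
  interpret flat_triple "int p" "int q" "int w" "int f" "int k"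
  proof
    show "0 < int f" using f gt1 by (cases f) auto
    show "0 < int k" using k gt1 by (cases k) auto
    show "int p = 1 + int w * int f" by (subst f) simp
    show "int q = 1 + int p * int w * int k" by (subst k) simp
  qed (use w in simp)
  define W where "W = (Abs_fps (\<lambda>n. of_int (chi (int n))) :: complex fps)"
  define l L where "l = w * k" and "L = (p - 1) * l"
  have ql: "q = 1 + l * p" using k by (simp add: l_def mult_ac)
  have "int (p * q) dvd int r - int w" using cong(1) by (metis cong_iff_dvd_diff cong_int_iff)
  then obtain c where "int r - int w = int (p * q) * c" by blast
  hence c: "int r = int w + int p * int q * c" by simp
  have coeff_shift: "(fps_X ^ (r * j) * W) $ n = (if int j \<le> int (n div r) then of_int (chi (int n - int w * int j)) else 0)" for j
  proof -
    have "j \<le> n div r \<longleftrightarrow> r * j \<le> n"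
      using prime_gt_0_nat[OF pr(3)] by (simp add: less_eq_div_iff_mult_less_eq mult.commute)
    moreover have "chi (int (n - r * j)) = chi (int n - int w * int j)" if "r * j \<le> n"
    proof -
      have "int (n - r * j) = int n - int w * int j - int p * int q * (c * int j)"
        using that c by (simp add: of_nat_diff algebra_simps)
      thus ?thesis by (simp only: chi_periodic)
    qed
    ultimately show ?thesis by (auto simp: W_def fps_X_power_mult_nth)
  qed
  have LL: "(int p - 1) * (int w * int k) = int L" using gt1 by (simp add: L_def l_def of_nat_diff)
  have "coeff (cyclotomic_poly (p * q * r)) n = fps_of_poly (cyclotomic_poly (p * q * r)) $ n" by simp
  also have "\<dots> = (\<Sum>i<L + 1. (fps_X ^ (r * (i * p)) * W) $ n) -
      (\<Sum>i<L. (fps_X ^ (r * (i * p + 1 + i div l)) * W) $ n)"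
    unfolding cyclotomic_poly_series[OF pr less ql chi_series[OF refl refl]] L_def[symmetric] W_def[symmetric]
    by (simp only: left_diff_distrib sum_distrib_right fps_sub_nth fps_sum_nth)
  also have "\<dots> = of_int (
    (\<Sum>i\<in>{0..<int L + 1}. if i * int p \<le> int (n div r) then chi (int n - int w * (i * int p)) else 0) -
    (\<Sum>i\<in>{0..<int L}. if i * int p + 1 + i div (int w * int k) \<le> int (n div r)
      then chi (int n - int w * (i * int p + 1 + i div (int w * int k))) else 0))"
  proof -
    have e: "int L + 1 = int (L + 1)" by simp
    have e1: "int i * int p = int (i * p)"
      and e2: "int i * int p + 1 + int i div (int w * int k) = int (i * p + 1 + i div l)" for i
      by (simp_all add: l_def zdiv_int)
    show ?thesis
      unfolding coeff_shift e sum_int_nat e2 unfolding e1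
      by (simp only: of_int_diff of_int_sum if_distrib[of of_int] of_int_0)
  qed
  finally show ?thesis
    using abs_prefix_le_1[of "int (n div r)" "int n"] unfolding LL
    by (simp only: norm_of_int of_nat_0_le_iff of_int_abs[symmetric] of_int_le_1_iff)
qed

theorem theorem8p10:
  fixes p q r w :: nat
  assumes "prime p" "prime q" "prime r"
    and "p < q" "q < r"
    and "w > 0"
    and "[r = w] (mod (p * q))"
    and "[p = 1] (mod w)"
    and "[q = 1] (mod (p * w))"
  shows "cyclotomic_height (p * q * r) = 1"
  unfolding cyclotomic_height_def
proof (rule Max_eqI)
  let ?P = "cyclotomic_poly (p * q * r)"
  show "finite ((\<lambda>i. cmod (coeff ?P i)) ` {..degree ?P})" by simp
  show "y \<le> 1" if "y \<in> (\<lambda>i. cmod (coeff ?P i)) ` {..degree ?P}" for y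
    using that norm_coeff_cyclotomic_poly_le_1[OF assms] by auto
  \<comment> \<open>The bound is attained because the polynomial is monic.\<close>
  have "lead_coeff ?P = 1" by (simp add: cyclotomic_poly_def lead_coeff_prod)
  thus "1 \<in> (\<lambda>i. cmod (coeff ?P i)) ` {..degree ?P}" by (intro image_eqI[of _ _ "degree ?P"]) auto
qed

end
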